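(* Suppose that $$c_h:=\sup_{0\ne v_h\in V_h}\frac{\|v_h\|_{V^*}}{\|v_h\|_{V_h^*}}<\infty\quad\text{for all } h .$$ Then the spatially semidiscrete Galerkin solution $u_h$ is quasi-optimal: $\mathbb P$-almost surely, $$\|u-u_h\|_{\mathcal Y}\le c_h\,(1+\rho)\inf_{y_h\in\mathcal Y^h}\|u-y_h\|_{\mathcal Y}.$$
   Context: Let $T\in(0,\infty)$ and let $(\Omega,\Sigma,\mathbb P)$ be a complete probability space with normal filtration $(\Sigma_t)_{t\in[0,T]}$. Let $V\subset H\subset V^*$ be a Gelfand triple of real separable Hilbert spaces, $V$ continuously and densely embedded in $H$; $\langle\cdot,\cdot\rangle_H$ is the inner product of $H$ and ${}_{V^*}\langle\cdot,\cdot\rangle_V$ the dual pairing, with ${}_{V^*}\langle u,v\rangle_V=\langle u,v\rangle_H$ for $u\in H$, $v\in V$. Let $A\colon[0,T]\times\Omega\to\mathcal L(V,V^* )$ be progressively measurable, put $a(t,\omega;u,v):={}_{V^*}\langle A(t,\omega)u,v\rangle_V$, and assume there are random variables $A_{\min},A_{\max}$, positive and finite $\mathbb P$-a.s., such that for all $t\in[0,T]$, $u,v\in V$: $$|a(t,\omega;u,v)|\le A_{\max}(\omega)\|u\|_V\|v\|_V,\qquad a(t,\omega;v,v)\ge A_{\min}(\omega)\|v\|_V^2 .$$ Put $\rho(\omega):=A_{\max}(\omega)/A_{\min}(\omega)$. Let $f$ be a progressively measurable $V^*$-valued process with $f(\cdot,\omega)\in L^2((0,T);V^* )$ and let $u_0$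 be measurable with $u_0(\omega)\in H$. Let $\mathcal Y:=L^2((0,T);V)$ with its usual norm, and $\mathcal X_{0,\{T\}}:=\{x\in L^2((0,T);V)\cap H^1((0,T);V^* ):x(T)=0\}$. For $y\in\mathcal Y$, $x\in\mathcal X_{0,\{T\}}$ define $$\mathcal B^*_\omega(y,x):=\int_0^T\big({}_V\langle y(t),-\dot x(t)\rangle_{V^*}+a(t,\omega;y(t),x(t))\big)dt,\qquad \mathcal F_\omega(x):=\int_0^T{}_{V^*}\langle f(t,\omega),x(t)\rangle_V\,dt+\langle u_0(\omega),x(0)\rangle_H .$$ For a.e. $\omega$, $u=u(\cdot,\omega)\in\mathcal Y$ is the unique solution of $\mathcal B^*_\omega(u,x)=\mathcal F_\omega(x)$ for all $x\in\mathcal X_{0,\{T\}}$. Let $(V_h)_h$ be a family of nonzero finite-dimensional subspaces of $V$. For $v_h\in V_h$ (identified with an element of $V^*$ and of $V_h^*$ through $\langle\cdot,\cdot\rangle_H$) put $$\|v_h\|_{V^*}=\sup_{w\in V,\ \|w\|_V=1}\langle v_h,w\rangle_H,\qquad \|v_h\|_{V_h^*}=\sup_{w_h\in V_h,\ \|w_h\|_V=1}\langle v_h,w_h\rangle_H .$$ Let $\mathcal Y^h:=L^2((0,T);V_h)$ (with the norm of $\mathcal Y$) and $\mathcal X^h_{0,\{T\}}:=\{x_h\in L^2((0,T);V_h)\cap H^1((0,T);V_h^* ):x_h(T)=0\}$. For a.e. $\omega$, $u_h=u_h(\cdot,\omega)\in\mathcal Y^h$ is the unique solution of the semidiscrete problem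 $\mathcal B^*_\omega(u_h,x_h)=\mathcal F_\omega(x_h)$ for all $x_h\in\mathcal X^h_{0,\{T\}}$. *)

theory Defs
  imports "HOL-Probability.Probability"
begin

section \<open>The dual of a separable Hilbert space is separable\<close>

text \<open>
  A real separable Hilbert space is a type of sort
  \<open>{real_inner, banach, second_countable_topology}\<close>; its dual is \<open>'a \<Rightarrow>\<^sub>L real\<close>.
  The library's Bochner integral requires a second-countable codomain, hence the following instance.
\<close>

lemma riesz_representation:
  fixes f :: "'a::{real_inner,complete_space} \<Rightarrow>\<^sub>L real"
  shows "\<exists>x. f = blinfun_inner_left x"
proof -
  define J where "J v = (norm v)\<^sup>2 - 2 * f v" for v
  define m where "m = (INF v. J v)"
  have lb: "- (norm f)\<^sup>2 \<le> J v" for v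
  proof -
    have "f v \<le> norm f * norm v"
      using norm_blinfun[of f v] by simp
    moreover have "0 \<le> (norm v - norm f)\<^sup>2"
      by simp
    ultimately show ?thesis
      unfolding J_def power2_diff by (simp add: algebra_simps)
  qed
  have bdd: "bdd_below (range J)"
    by (rule bdd_belowI[of _ "- (norm f)\<^sup>2"]) (use lb in auto)
  have m_le: "m \<le> J v" for v
    unfolding m_def by (rule cINF_lower[OF bdd]) simp
  have par: "(norm (v - w))\<^sup>2 = 2 * J v + 2 * J w - 4 * J ((1/2) *\<^sub>R (v + w))" for v w
    unfolding J_def power2_norm_eq_inner
    by (simp add: blinfun.scaleR_right blinfun.add_right inner_simps inner_commute algebra_simps)
  have "\<exists>v. J v < m + 1 / real (Suc n)" for n
    using cInf_lessD[of "range J" "m + 1 / real (Suc n)"] unfolding m_def by auto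
  then obtain s where s: "J (s n) < m + 1 / real (Suc n)" for n
    by metis
  have dist_s: "(dist (s k) (s l))\<^sup>2 \<le> 4 / real (Suc n)" if "n \<le> k" "n \<le> l" for k l n
  proof -
    have "J (s k) \<le> m + 1 / real (Suc n)" "J (s l) \<le> m + 1 / real (Suc n)"
      using s[of k] s[of l] that frac_le[of 1 1 "real (Suc n)" "real (Suc k)"]
        frac_le[of 1 1 "real (Suc n)" "real (Suc l)"] by fastforce+
    then show ?thesis
      using par[of "s k" "s l"] m_le[of "(1/2) *\<^sub>R (s k + s l)"] by (simp add: dist_norm)
  qed
  have "Cauchy s"
  proof (rule metric_CauchyI)
    fix e :: real assume "0 < e"
    obtain n where "4 / e\<^sup>2 < real n"
      using reals_Archimedean2 by blast
    then have n: "4 / e\<^sup>2 < real (Suc n)"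
      by simp
    have "dist (s k) (s l) < e" if "n \<le> k" "n \<le> l" for k l
    proof -
      have "4 / real (Suc n) < e\<^sup>2"
        using n \<open>0 < e\<close> by (simp add: field_simps)
      then have "(dist (s k) (s l))\<^sup>2 < e\<^sup>2"
        using dist_s[OF that] by linarith
      then show ?thesis
        using \<open>0 < e\<close> by (simp add: power_less_imp_less_base)
    qed
    then show "\<exists>M. \<forall>k\<ge>M. \<forall>l\<ge>M. dist (s k) (s l) < e"
      by blast
  qed
  then obtain x where x: "s \<longlonglongrightarrow> x"
    using Cauchy_convergent convergent_def by blast
  have "(\<lambda>n. J (s n)) \<longlonglongrightarrow> J x"
    unfolding J_def by (intro tendsto_intros x)
  moreover have "(\<lambda>n. m + 1 / real (Suc n)) \<longlonglongrightarrow> m + 0"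
    by (intro tendsto_intros LIMSEQ_Suc lim_1_over_n)
  ultimately have "J x \<le> m + 0"
    by (rule LIMSEQ_le) (use s less_imp_le in blast)
  then have min: "J x \<le> J v" for v
    using m_le[of v] by linarith
  have "f v = v \<bullet> x" for v
  proof (rule ccontr)
    assume ne: "f v \<noteq> v \<bullet> x"
    define d where "d = f v - v \<bullet> x"
    define t where "t = d / (1 + (norm v)\<^sup>2)"
    have pos: "0 < 1 + (norm v)\<^sup>2"
      by (simp add: add_pos_nonneg)
    have "J (x + t *\<^sub>R v) = J x - 2 * t * d + t\<^sup>2 * (norm v)\<^sup>2"
      unfolding J_def d_def power2_norm_eq_inner
      by (simp add: blinfun.scaleR_right blinfun.add_right inner_simps inner_commute
          power2_eq_square algebra_simps)
    with min[of "x + t *\<^sub>R v"] have "2 * t * d \<le> t\<^sup>2 * (norm v)\<^sup>2"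
      by simp
    also have "\<dots> \<le> t\<^sup>2 * (1 + (norm v)\<^sup>2)"
      by (simp add: mult_left_mono)
    also have "\<dots> = t * d"
      using pos unfolding t_def power2_eq_square by simp
    finally have "t * d \<le> 0"
      by (simp add: mult.commute)
    moreover have "0 < t * d"
      using ne pos unfolding t_def d_def by (simp add: zero_less_mult_iff zero_less_divide_iff) linarith
    ultimately show False
      by simp
  qed
  then have "f = blinfun_inner_left x"
    by (intro blinfun_eqI) simp
  then show ?thesis ..
qed

lemma countable_dense_imp_ex_subbasis:
  fixes C :: "'a::metric_space set"
  assumes "countable C" and dense: "\<And>x e. 0 < e \<Longrightarrow> \<exists>c\<in>C. dist x c < e"
  shows "\<exists>B::'a set set. countable B \<and> open = generate_topology B"
proof -
  define B where "B = (\<lambda>(c, n). ball c (1 / real (Suc n))) ` (C \<times> (UNIV :: nat set))"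
  have "countable B"
    unfolding B_def using assms(1) by (intro countable_image countable_SIGMA) auto
  moreover have "topological_basis B"
  proof (rule topological_basisI)
    fix S :: "'a set" and x assume "open S" "x \<in> S"
    then obtain e where e: "0 < e" "ball x e \<subseteq> S"
      by (meson open_contains_ball)
    then obtain n where n: "1 / real (Suc n) < e / 2"
      using nat_approx_posE[of "e / 2"] by auto
    obtain c where c: "c \<in> C" "dist x c < 1 / real (Suc n)"
      using dense[of "1 / real (Suc n)" x] by auto
    have "ball c (1 / real (Suc n)) \<subseteq> ball x e"
    proof
      fix y assume "y \<in> ball c (1 / real (Suc n))"
      then show "y \<in> ball x e"
        using c(2) n dist_triangle[of x y c] by simp
    qed
    moreover have "x \<in> ball c (1 / real (Suc n))"
      using c(2) by (simp add: dist_commute)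
    ultimately show "\<exists>B'\<in>B. x \<in> B' \<and> B' \<subseteq> S"
      using e(2) c(1) unfolding B_def
      by (intro bexI[of _ "ball c (1 / real (Suc n))"]) auto
  qed (auto simp: B_def)
  ultimately show ?thesis
    using topological_basis_imp_subbasis by blast
qed

instance blinfun :: ("{real_inner,banach,second_countable_topology}", euclidean_space)
  second_countable_topology
proof
  obtain D :: "'a set" where D: "countable D" "\<And>X. open X \<Longrightarrow> X \<noteq> {} \<Longrightarrow> \<exists>d\<in>D. d \<in> X"
    using countable_dense_setE by blast
  define \<Phi> :: "('b \<Rightarrow> 'a) \<Rightarrow> 'a \<Rightarrow>\<^sub>L 'b" where
    "\<Phi> d = (\<Sum>b\<in>Basis. blinfun_scaleR_left b o\<^sub>L blinfun_inner_left (d b))" for d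
  have apply_\<Phi>: "\<Phi> d v = (\<Sum>b\<in>Basis. (v \<bullet> d b) *\<^sub>R b)" for d v
    unfolding \<Phi>_def by (simp add: blinfun.sum_left)
  have lip: "dist (\<Phi> x) (\<Phi> d) \<le> (\<Sum>b\<in>Basis. dist (x b) (d b))" for x d
    unfolding dist_norm
  proof (rule norm_blinfun_bound)
    fix v
    have "(\<Phi> x - \<Phi> d) v = (\<Sum>b\<in>Basis. (v \<bullet> (x b - d b)) *\<^sub>R b)"
      by (simp add: blinfun.diff_left apply_\<Phi> inner_diff_right scaleR_diff_left sum_subtractf)
    also have "norm \<dots> \<le> (\<Sum>b\<in>Basis. norm (x b - d b) * norm v)"
      by (rule sum_norm_le)
        (simp add: mult.commute Cauchy_Schwarz_ineq2[THEN order_trans])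
    finally show "norm ((\<Phi> x - \<Phi> d) v) \<le> (\<Sum>b\<in>Basis. norm (x b - d b)) * norm v"
      by (simp add: sum_distrib_right)
  qed (simp add: sum_nonneg)
  have surj: "\<exists>x. f = \<Phi> x" for f
  proof -
    have "\<exists>x. \<forall>v. f v \<bullet> b = v \<bullet> x" for b
    proof -
      obtain x where "blinfun_inner_left b o\<^sub>L f = blinfun_inner_left x"
        using riesz_representation by blast
      then have "(blinfun_inner_left b o\<^sub>L f) v = blinfun_inner_left x v" for v
        by simp
      then show ?thesis
        by auto
    qed
    then obtain x where "f v \<bullet> b = v \<bullet> x b" for v b
      by metis
    then have "f v = \<Phi> x v" for v
      using euclidean_representation[of "f v"] by (simp add: apply_\<Phi>)
    then have "f = \<Phi> x"
      by (rule blinfun_eqI)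
    then show ?thesis
      by (rule exI[of _ x])
  qed
  show "\<exists>B::('a \<Rightarrow>\<^sub>L 'b) set set. countable B \<and> open = generate_topology B"
  proof (rule countable_dense_imp_ex_subbasis)
    show "countable (\<Phi> ` (Basis \<rightarrow>\<^sub>E D))"
      using D(1) by (intro countable_image countable_PiE) auto
    fix f :: "'a \<Rightarrow>\<^sub>L 'b" and e :: real assume "0 < e"
    obtain x where x: "f = \<Phi> x"
      using surj by blast
    have "\<exists>d\<in>D. dist (x b) d < e / DIM('b)" for b
      using D(2)[of "ball (x b) (e / DIM('b))"] divide_pos_pos[OF \<open>0 < e\<close>, of "DIM('b)"] by auto
    then obtain d where d: "d b \<in> D" "dist (x b) (d b) < e / DIM('b)" for b
      by metis
    have "dist f (\<Phi> (restrict d Basis)) \<le> (\<Sum>b\<in>Basis. dist (x b) (d b))"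
      using lip[of x "restrict d Basis"] by (simp add: x)
    also have "\<dots> < (\<Sum>b\<in>(Basis :: 'b set). e / DIM('b))"
      by (rule sum_strict_mono) (use d in auto)
    also have "\<dots> = e"
      by simp
    finally show "\<exists>c\<in>\<Phi> ` (Basis \<rightarrow>\<^sub>E D). dist f c < e"
      using d(1) by (intro bexI[of _ "\<Phi> (restrict d Basis)"]) auto
  qed
qed

section \<open>Filtrations and progressive measurability\<close>

text \<open>\<open>M\<close> is assumed complete, so \<open>null_sets M\<close> consists of all \<open>M\<close>-negligible sets.\<close>

definition normal_filtration :: "'w measure \<Rightarrow> real \<Rightarrow> (real \<Rightarrow> 'w measure) \<Rightarrow> bool" where
  "normal_filtration M T F \<longleftrightarrow>
     (\<forall>t\<in>{0..T}. subalgebra M (F t)) \<and>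
     (\<forall>t\<in>{0..T}. \<forall>s\<in>{0..t}. sets (F s) \<subseteq> sets (F t)) \<and>
     null_sets M \<subseteq> sets (F 0) \<and>
     (\<forall>t\<in>{0..<T}. sets (F t) = (\<Inter>s\<in>{t<..T}. sets (F s)))"

text \<open>A process of bounded operators is called progressively measurable in the strong sense: all
  processes \<open>\<lambda>t \<omega>. A t \<omega> v\<close> with fixed \<open>v\<close> are.  Measurability for the Borel sets of the
  operator norm would be a stronger requirement, as that norm is not separable.\<close>

definition prog_measurable ::
  "real \<Rightarrow> (real \<Rightarrow> 'w measure) \<Rightarrow> (real \<Rightarrow> 'w \<Rightarrow> 'a::topological_space) \<Rightarrow> bool" where
  "prog_measurable T F X \<longleftrightarrow>
     (\<forall>t\<in>{0..T}. (\<lambda>(s, \<omega>). X s \<omega>) \<in> borel_measurable (restrict_space borel {0..t} \<Otimes>\<^sub>M F t))"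

section \<open>Gelfand triples\<close>

text \<open>The embedding of \<open>V\<close> into \<open>H\<close> is \<open>\<iota>\<close>.  The type \<open>'v \<Rightarrow>\<^sub>L real\<close> is \<open>V\<^sup>*\<close>, and the duality
  pairing is application.\<close>

definition gelfand_triple :: "('v::real_inner \<Rightarrow>\<^sub>L 'h::real_inner) \<Rightarrow> bool" where
  "gelfand_triple \<iota> \<longleftrightarrow> inj (blinfun_apply \<iota>) \<and> closure (range (blinfun_apply \<iota>)) = UNIV"

text \<open>\<open>V\<close> as a subset of \<open>V\<^sup>*\<close>: \<open>v\<close> becomes the functional \<open>w \<mapsto> \<langle>v, w\<rangle>\<^sub>H\<close>.\<close>

definition to_dual :: "('v::real_inner \<Rightarrow>\<^sub>L 'h::real_inner) \<Rightarrow> 'v \<Rightarrow> ('v \<Rightarrow>\<^sub>L real)" where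
  "to_dual \<iota> v = blinfun_inner_right (\<iota> v) o\<^sub>L \<iota>"

text \<open>For a subspace \<open>W\<close> of \<open>V\<close> and \<open>v \<in> W\<close> this is the norm of \<open>v\<close> in \<open>W\<^sup>*\<close>.\<close>

definition dual_norm :: "('v::real_inner \<Rightarrow>\<^sub>L 'h::real_inner) \<Rightarrow> 'v set \<Rightarrow> 'v \<Rightarrow> real" where
  "dual_norm \<iota> W v = (SUP w\<in>{w\<in>W. norm w = 1}. \<iota> v \<bullet> \<iota> w)"

definition dual_norm_ratios :: "('v::real_inner \<Rightarrow>\<^sub>L 'h::real_inner) \<Rightarrow> 'v set \<Rightarrow> real set" where
  "dual_norm_ratios \<iota> W = (\<lambda>v. dual_norm \<iota> UNIV v / dual_norm \<iota> W v) ` (W - {0})"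

section \<open>Spaces of functions of time\<close>

text \<open>Elements of \<open>L\<^sup>2((0,T);E)\<close> are represented by functions on the real line; only their values
  almost everywhere on \<open>(0,T)\<close> matter.\<close>

definition Lsq :: "real \<Rightarrow> (real \<Rightarrow> 'e::real_normed_vector) set" where
  "Lsq T = {x. x \<in> borel_measurable (lebesgue_on {0<..<T}) \<and>
               integrable (lebesgue_on {0<..<T}) (\<lambda>t. (norm (x t))\<^sup>2)}"

definition Lsq_norm :: "real \<Rightarrow> (real \<Rightarrow> 'e::real_normed_vector) \<Rightarrow> real" where
  "Lsq_norm T x = sqrt (LINT t|lebesgue_on {0<..<T}. (norm (x t))\<^sup>2)"

text \<open>Weak derivatives are tested with \<open>C\<^sup>1\<close> functions of compact support in \<open>(0,T)\<close>, as in Brezis,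
  \<^emph>\<open>Functional Analysis, Sobolev Spaces and Partial Differential Equations\<close>.\<close>

definition weak_deriv ::
  "real \<Rightarrow> (real \<Rightarrow> 'e::{banach,second_countable_topology}) \<Rightarrow> (real \<Rightarrow> 'e) \<Rightarrow> bool" where
  "weak_deriv T x g \<longleftrightarrow>
     (\<forall>\<phi> \<phi>' a b. 0 < a \<and> b < T \<and> (\<forall>t. t \<notin> {a..b} \<longrightarrow> \<phi> t = 0) \<and>
        (\<forall>t. (\<phi> has_real_derivative \<phi>' t) (at t)) \<and> continuous_on UNIV \<phi>' \<longrightarrow>
        (LINT t|lebesgue_on {0<..<T}. \<phi>' t *\<^sub>R x t) =
        - (LINT t|lebesgue_on {0<..<T}. \<phi> t *\<^sub>R g t))"

text \<open>For \<open>x\<close> in \<open>L\<^sup>2((0,T);V) \<inter> H\<^sup>1((0,T);V\<^sup>*)\<close>, the weak derivative of \<open>x\<close> in \<open>V\<^sup>*\<close>; it is unique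
  almost everywhere.\<close>

definition time_deriv ::
  "real \<Rightarrow> ('v::{real_inner,banach,second_countable_topology} \<Rightarrow>\<^sub>L 'h::real_inner) \<Rightarrow>
   (real \<Rightarrow> 'v) \<Rightarrow> real \<Rightarrow> ('v \<Rightarrow>\<^sub>L real)" where
  "time_deriv T \<iota> x = (SOME g. g \<in> Lsq T \<and> weak_deriv T (\<lambda>t. to_dual \<iota> (x t)) g)"

text \<open>The value \<open>x(s) \<in> H\<close>, at any \<open>s \<in> [0,T]\<close>, of the representative of \<open>x\<close> that is continuous
  from \<open>[0,T]\<close> to \<open>H\<close>.\<close>

definition point_value ::
  "real \<Rightarrow> ('v::real_inner \<Rightarrow>\<^sub>L 'h::real_inner) \<Rightarrow> (real \<Rightarrow> 'v) \<Rightarrow> real \<Rightarrow> 'h" where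
  "point_value T \<iota> x s =
     (THE h. \<exists>g. continuous_on {0..T} g \<and> (AE t in lebesgue_on {0<..<T}. g t = \<iota> (x t)) \<and> g s = h)"

definition X_space ::
  "real \<Rightarrow> ('v::{real_inner,banach,second_countable_topology} \<Rightarrow>\<^sub>L 'h::real_inner) \<Rightarrow>
   (real \<Rightarrow> 'v) set" where
  "X_space T \<iota> = {x \<in> Lsq T. (\<exists>g\<in>Lsq T. weak_deriv T (\<lambda>t. to_dual \<iota> (x t)) g) \<and>
                             point_value T \<iota> x T = 0}"

definition Yh_space :: "real \<Rightarrow> 'v::real_inner set \<Rightarrow> (real \<Rightarrow> 'v) set" where
  "Yh_space T W = {y \<in> Lsq T. AE t in lebesgue_on {0<..<T}. y t \<in> W}"

text \<open>Here \<open>W\<close> is finite-dimensional, so \<open>w \<mapsto> \<langle>w, \<cdot>\<rangle>\<^sub>H\<close> identifies \<open>W\<close> with \<open>W\<^sup>*\<close>, and the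
  derivative in \<open>L\<^sup>2((0,T);W\<^sup>*)\<close> is represented by a \<open>W\<close>-valued function \<open>g\<close>.\<close>

definition Xh_space ::
  "real \<Rightarrow> ('v::{real_inner,banach,second_countable_topology} \<Rightarrow>\<^sub>L 'h::real_inner) \<Rightarrow>
   'v set \<Rightarrow> (real \<Rightarrow> 'v) set" where
  "Xh_space T \<iota> W =
     {x \<in> Yh_space T W.
        (\<exists>g. g \<in> borel_measurable (lebesgue_on {0<..<T}) \<and>
             (AE t in lebesgue_on {0<..<T}. g t \<in> W) \<and>
             integrable (lebesgue_on {0<..<T}) (\<lambda>t. (dual_norm \<iota> W (g t))\<^sup>2) \<and>
             weak_deriv T x g) \<and>
        point_value T \<iota> x T = 0}"

section \<open>The weak space-time formulation\<close>

text \<open>\<open>A\<close>, \<open>f\<close> and \<open>u\<^sub>0\<close> are the data for one fixed outcome.  On functions \<open>x\<close> from \<open>Xh_space\<close> the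
  derivative \<open>time_deriv T \<iota> x\<close> in \<open>V\<^sup>*\<close> is \<open>to_dual \<iota> \<circ> g\<close>, with \<open>g\<close> as in \<open>Xh_space_def\<close>.\<close>

definition B_star ::
  "real \<Rightarrow> ('v::{real_inner,banach,second_countable_topology} \<Rightarrow>\<^sub>L 'h::real_inner) \<Rightarrow>
   (real \<Rightarrow> 'v \<Rightarrow>\<^sub>L ('v \<Rightarrow>\<^sub>L real)) \<Rightarrow> (real \<Rightarrow> 'v) \<Rightarrow> (real \<Rightarrow> 'v) \<Rightarrow> real" where
  "B_star T \<iota> A y x =
     (LINT t|lebesgue_on {0<..<T}. (- time_deriv T \<iota> x t) (y t) + A t (y t) (x t))"

definition F_load ::
  "real \<Rightarrow> ('v::real_inner \<Rightarrow>\<^sub>L 'h::real_inner) \<Rightarrow> (real \<Rightarrow> 'v \<Rightarrow>\<^sub>L real) \<Rightarrow> 'h \<Rightarrow>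
   (real \<Rightarrow> 'v) \<Rightarrow> real" where
  "F_load T \<iota> f u\<^sub>0 x =
     (LINT t|lebesgue_on {0<..<T}. f t (x t)) + u\<^sub>0 \<bullet> point_value T \<iota> x 0"

end

theory Submission
  imports Defs
begin

text \<open>Fix an outcome.  Let \<open>Q\<close> be the projection onto \<open>V\<^sub>h\<close> that is orthogonal in \<open>H\<close>.  By duality \<open>c\<^sub>h\<close> bounds
  the \<open>V\<close>-norm of \<open>Q\<close>, and hence also that of \<open>1 - Q\<close>, since a nontrivial projection in a Hilbert space has
  the same norm as its complement.

  Let \<open>z\<^sub>h\<close> be the Galerkin projection of \<open>y\<close>, and let \<open>x\<^sub>h\<close> solve the discrete backward problem
  \<open>\<B>\<^sup>*(w\<^sub>h, x\<^sub>h) = \<integral> \<langle>z\<^sub>h, w\<^sub>h\<rangle>\<^sub>V\<close>, so that the norm of \<open>x\<^sub>h\<close> is at most \<open>1 / A\<^sub>m\<^sub>i\<^sub>n\<close> times that of \<open>z\<^sub>h\<close>.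
  Since the time derivative of \<open>x\<^sub>h\<close> is \<open>V\<^sub>h\<close>-valued, it does not see \<open>y - Q y\<close>, whence
  \<open>\<parallel>z\<^sub>h\<parallel>\<^sup>2 = \<B>\<^sup>*(y, x\<^sub>h) = \<integral> \<langle>z\<^sub>h, Q y\<rangle>\<^sub>V + a(y - Q y, x\<^sub>h) \<le> c\<^sub>h (1 + \<rho>) \<parallel>y\<parallel> \<parallel>z\<^sub>h\<parallel>\<close>.
  Thus the Galerkin projection has norm at most \<open>c\<^sub>h (1 + \<rho>)\<close>, and so does its complement, which maps
  \<open>u - y\<^sub>h\<close> to \<open>u - u\<^sub>h\<close>.\<close>

text \<open>The norm of a projection bounds the norm of its complement, in terms of \<open>a = \<parallel>p\<parallel>\<^sup>2\<close>, \<open>b = \<langle>p, q\<rangle>\<close> and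
  \<open>d = \<parallel>q\<parallel>\<^sup>2\<close> for \<open>p\<close> in the range and \<open>q\<close> in the kernel.  The vector with \<open>\<alpha> = \<parallel>q\<parallel> / \<parallel>p\<parallel>\<close> and
  \<open>\<beta> = 1 / \<alpha>\<close> has the norm of \<open>p + q\<close>, but its projection has the norm of \<open>q\<close>.\<close>

lemma projection_complement_bound:
  fixes a b d K :: real
  assumes K: "1 \<le> K" and a: "0 \<le> a" and d: "0 \<le> d"
    and H: "\<And>\<alpha> \<beta>. \<alpha>\<^sup>2 * a \<le> K\<^sup>2 * (\<alpha>\<^sup>2 * a + 2 * \<alpha> * \<beta> * b + \<beta>\<^sup>2 * d)"
  shows "d \<le> K\<^sup>2 * (a + 2 * b + d)"
proof -
  have K2: "1 \<le> K\<^sup>2"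
    using K by simp
  have pos: "0 \<le> \<alpha>\<^sup>2 * a + 2 * \<alpha> * \<beta> * b + \<beta>\<^sup>2 * d" for \<alpha> \<beta>
  proof -
    have "0 \<le> \<alpha>\<^sup>2 * a"
      using a by simp
    then have "0 \<le> K\<^sup>2 * (\<alpha>\<^sup>2 * a + 2 * \<alpha> * \<beta> * b + \<beta>\<^sup>2 * d)"
      using H[of \<alpha> \<beta>] by linarith
    then show ?thesis
      using K2 K by (auto simp: zero_le_mult_iff)
  qed
  consider "b = 0" | "b \<noteq> 0" "a = 0" | "b \<noteq> 0" "d = 0" | "0 < a" "0 < d"
    using a d by fastforce
  then show ?thesis
  proof cases
    case 1
    have "d \<le> K\<^sup>2 * d" "0 \<le> K\<^sup>2 * a"
      using K2 d a mult_right_mono[of 1 "K\<^sup>2" d] by simp_all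
    then show ?thesis
      using 1 by (simp add: distrib_left)
  next
    case 2
    then have "0 \<le> 2 * (- (d + 1) / (2 * b)) * b + d"
      using pos[of "- (d + 1) / (2 * b)" 1] by simp
    moreover have "2 * (- (d + 1) / (2 * b)) * b = - (d + 1)"
      using 2 by simp
    ultimately show ?thesis
      by linarith
  next
    case 3
    then have "0 \<le> a + 2 * (- (a + 1) / (2 * b)) * b"
      using pos[of 1 "- (a + 1) / (2 * b)"] by simp
    moreover have "2 * (- (a + 1) / (2 * b)) * b = - (a + 1)"
      using 3 by simp
    ultimately show ?thesis
      by linarith
  next
    case 4
    have "sqrt (d / a) * sqrt (a / d) = 1"
      using 4 by (simp add: real_sqrt_mult[symmetric])
    moreover have "(sqrt (d / a))\<^sup>2 = d / a" "(sqrt (a / d))\<^sup>2 = a / d"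
      using 4 by simp_all
    ultimately show ?thesis
      using H[of "sqrt (d / a)" "sqrt (a / d)"] 4 by (simp add: algebra_simps)
  qed
qed

section \<open>Integration on a bounded time interval\<close>

abbreviation time_measure :: "real \<Rightarrow> real measure" where
  "time_measure T \<equiv> lebesgue_on {0<..<T}"

lemma finite_time_measure: "finite_measure (time_measure T)"
  by (rule finite_measure_lebesgue_on) (metis box_real(1) lmeasurable_box)

lemma time_measure_borel_measurable:
  "f \<in> borel_measurable borel \<Longrightarrow> f \<in> borel_measurable (time_measure T)"
  by (metis borel_measurable_if_D measurable_completion measurable_lborel2 
      measurable_restrict_space1)

lemma AE_time_measure_neq: "AE s in time_measure T. s \<noteq> t"
proof -
  have "AE s in lebesgue. s \<noteq> t"
    by (intro AE_completion AE_lborel_singleton)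
  then show ?thesis
    by (auto simp: AE_restrict_space_iff)
qed

text \<open>Only the values of \<open>\<phi>\<close> on the compact interval \<open>{0..T}\<close>
  count, and there it is bounded. Integrals against test functions can then be split by
  linearity.\<close>

lemma integrable_continuous_scaleR:
  fixes h :: "real \<Rightarrow> 'e::{banach,second_countable_topology}"
  assumes \<phi>: "continuous_on UNIV \<phi>" and h: "integrable (time_measure T) h"
  shows "integrable (time_measure T) (\<lambda>t. \<phi> t *\<^sub>R h t)"
proof -
  have "compact (\<phi> ` {0..T})"
    by (intro compact_continuous_image continuous_on_subset[OF \<phi>]) auto
  then obtain K where K: "\<forall>t\<in>{0..T}. \<bar>\<phi> t\<bar> \<le> K"
    by (auto dest!: compact_imp_bounded simp: bounded_iff)
  show ?thesis
  proof (rule Bochner_Integration.integrable_bound)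
    show "integrable (time_measure T) (\<lambda>t. K * norm (h t))"
      using h by simp
    have "\<phi> \<in> borel_measurable (time_measure T)"
      by (intro time_measure_borel_measurable borel_measurable_continuous_onI \<phi>)
    then show "(\<lambda>t. \<phi> t *\<^sub>R h t) \<in> borel_measurable (time_measure T)"
      using h by (intro borel_measurable_scaleR) auto
    have "norm (\<phi> t *\<^sub>R h t) \<le> \<bar>K * norm (h t)\<bar>" if "t \<in> {0..T}" for t
      using mult_right_mono[OF K[rule_format, OF that] norm_ge_zero[of "h t"]] by simp
    then show "AE t in time_measure T. norm (\<phi> t *\<^sub>R h t) \<le> norm (K * norm (h t))"
      by (intro AE_I2) (simp add: space_restrict_space)
  qed
qed

lemma integrable_continuous_time:
  fixes f :: "real \<Rightarrow> real"
  assumes "continuous_on UNIV f"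
  shows "integrable (time_measure T) f"
proof -
  interpret finite_measure "time_measure T" by (rule finite_time_measure)
  show ?thesis
    using integrable_continuous_scaleR[OF assms, of T "\<lambda>_. 1::real"] by simp
qed

lemma integrable_mult_of_square_integrable:
  fixes f g :: "'a \<Rightarrow> real"
  assumes [measurable]: "f \<in> borel_measurable M" "g \<in> borel_measurable M"
    and "integrable M (\<lambda>x. (f x)\<^sup>2)" "integrable M (\<lambda>x. (g x)\<^sup>2)"
  shows "integrable M (\<lambda>x. f x * g x)"
proof (rule Bochner_Integration.integrable_bound)
  show "integrable M (\<lambda>x. (f x)\<^sup>2 + (g x)\<^sup>2)"
    using assms by simp
  have "\<bar>y * z\<bar> \<le> y\<^sup>2 + z\<^sup>2" for y z :: real
    using sum_squares_bound[of "\<bar>y\<bar>" "\<bar>z\<bar>"] mult_nonneg_nonneg[of "\<bar>y\<bar>" "\<bar>z\<bar>"]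
    unfolding abs_mult power2_abs by linarith
  then show "AE x in M. norm (f x * g x) \<le> norm ((f x)\<^sup>2 + (g x)\<^sup>2)"
    by simp
qed simp

text \<open>The integral of \<open>(f x - s * g x)\<^sup>2\<close> is a nonnegative quadratic
  polynomial in \<open>s\<close>; inserting its minimiser \<open>b / d\<close> gives the
  discriminant inequality.\<close>

lemma integral_Cauchy_Schwarz:
  fixes f g :: "'a \<Rightarrow> real"
  assumes m: "f \<in> borel_measurable M" "g \<in> borel_measurable M"
    and f: "integrable M (\<lambda>x. (f x)\<^sup>2)" and g: "integrable M (\<lambda>x. (g x)\<^sup>2)"
  shows "(LINT x|M. f x * g x) \<le> sqrt (LINT x|M. (f x)\<^sup>2) * sqrt (LINT x|M. (g x)\<^sup>2)"
proof -
  define a b d where "a = (LINT x|M. (f x)\<^sup>2)" and "b = (LINT x|M. f x * g x)"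
    and "d = (LINT x|M. (g x)\<^sup>2)"
  note fg = integrable_mult_of_square_integrable[OF m f g]
  have ad: "0 \<le> a" "0 \<le> d"
    unfolding a_def d_def by simp_all
  have pos: "0 \<le> a - 2 * s * b + s\<^sup>2 * d" for s
  proof -
    have "0 \<le> (LINT x|M. (f x - s * g x)\<^sup>2)"
      by simp
    also have "\<dots> = (LINT x|M. (f x)\<^sup>2 - 2 * s * (f x * g x) + s\<^sup>2 * (g x)\<^sup>2)"
      by (rule Bochner_Integration.integral_cong) (auto simp: power2_eq_square algebra_simps)
    also have "\<dots> = a - 2 * s * b + s\<^sup>2 * d"
      unfolding a_def b_def d_def using f g fg by simp
    finally show ?thesis .
  qed
  have "b\<^sup>2 \<le> a * d"
  proof (cases "d = 0")
    case True
    have "b = 0"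
    proof (rule ccontr)
      assume "b \<noteq> 0"
      \<comment> \<open>Without a quadratic term the polynomial takes the value -1 at this
        point.\<close>
      then show False
        using pos[of "(a + 1) / (2 * b)"] True by simp
    qed
    then show ?thesis
      using True by simp
  next
    case False
    then have "0 < d" using ad by simp
    then show ?thesis
      using pos[of "b / d"] by (simp add: field_simps power2_eq_square)
  qed
  then have "b \<le> sqrt (a * d)"
    by (rule real_le_rsqrt)
  then show ?thesis
    by (simp add: a_def b_def d_def real_sqrt_mult)
qed

section \<open>Tail integrals and integration by parts\<close>

text \<open>On \<open>{0..T}\<close> this is the primitive of \<open>- r\<close> that vanishes at
  \<open>T\<close>, so a backward problem with zero terminal value becomes an integral equation. The
  indicator gives it a meaning on the whole line.\<close>

definition tail_int :: "real \<Rightarrow> (real \<Rightarrow> real) \<Rightarrow> real \<Rightarrow> real" where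
  "tail_int T r t = (LINT s|time_measure T. indicator {t<..} s * r s)"

lemma integrable_tail:
  assumes "integrable (time_measure T) r"
  shows "integrable (time_measure T) (\<lambda>s. indicator {t<..} s * r s :: real)"
proof (rule Bochner_Integration.integrable_bound[OF assms])
  have "(indicator {t<..} :: real \<Rightarrow> real) \<in> borel_measurable (time_measure T)"
    by (rule time_measure_borel_measurable) simp
  then show "(\<lambda>s. indicator {t<..} s * r s) \<in> borel_measurable (time_measure T)"
    using assms by (intro borel_measurable_times) auto
qed (auto simp: indicator_def)

lemma tail_int_T: "tail_int T r T = 0"
proof -
  have "tail_int T r T = (LINT s|time_measure T. 0)"
    unfolding tail_int_def by (rule Bochner_Integration.integral_cong) (auto simp: space_restrict_space)
  then show ?thesis by simp
qed

lemma tail_int_diff: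
  assumes "integrable (time_measure T) r" "integrable (time_measure T) r'"
  shows "tail_int T (\<lambda>s. r s - r' s) t = tail_int T r t - tail_int T r' t"
  unfolding tail_int_def right_diff_distrib
  by (intro Bochner_Integration.integral_diff integrable_tail assms)

lemma abs_tail_int_le:
  assumes "integrable (time_measure T) r" "integrable (time_measure T) k"
    and "\<And>s. s \<in> {0<..<T} \<Longrightarrow> \<bar>r s\<bar> \<le> k s"
  shows "\<bar>tail_int T r t\<bar> \<le> tail_int T k t"
proof -
  have "\<bar>tail_int T r t\<bar> \<le> (LINT s|time_measure T. \<bar>indicator {t<..} s * r s\<bar>)"
    unfolding tail_int_def by (rule integral_abs_bound)
  also have "\<dots> \<le> tail_int T k t"
    unfolding tail_int_def
    by (intro integral_mono integrable_abs integrable_tail assms)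
      (use assms(3) in \<open>auto simp: space_restrict_space indicator_def\<close>)
  finally show ?thesis .
qed

text \<open>Dominated convergence with majorant \<open>\<bar>r s\<bar>\<close>: as \<open>t\<close>
  varies, the indicators converge at every \<open>s\<close> except \<open>t\<close> itself, a null
  set.\<close>

lemma continuous_tail_int:
  assumes "integrable (time_measure T) r"
  shows "continuous_on UNIV (tail_int T r)"
proof (rule continuous_at_imp_continuous_on, rule ballI)
  fix t :: real
  show "isCont (tail_int T r) t"
    unfolding isCont_def
  proof (subst tendsto_at_iff_sequentially, intro allI impI)
    fix X :: "nat \<Rightarrow> real" assume X: "X \<longlonglongrightarrow> t"
    show "(tail_int T r \<circ> X) \<longlonglongrightarrow> tail_int T r t"
      unfolding tail_int_def comp_def
    proof (rule integral_dominated_convergence[where w = "\<lambda>s. \<bar>r s\<bar>"])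
      show "AE s in time_measure T. (\<lambda>n. indicator {X n<..} s * r s) \<longlonglongrightarrow> indicator {t<..} s * r s"
        using AE_time_measure_neq[of t]
      proof eventually_elim
        case (elim s)
        then consider "s < t" | "t < s" by linarith
        then have "\<forall>\<^sub>F n in sequentially. indicator {X n<..} s = (indicator {t<..} s :: real)"
        proof cases
          case 1
          then show ?thesis
            using order_tendstoD(1)[OF X 1] by (auto elim!: eventually_mono)
        next
          case 2
          then show ?thesis
            using order_tendstoD(2)[OF X 2] by (auto elim!: eventually_mono)
        qed
        then show ?case
          by (intro tendsto_mult tendsto_const tendsto_eventually)
      qed
    qed (use assms integrable_tail[OF assms] in \<open>auto simp: indicator_def\<close>)
  qed
qed

text \<open>The integral is moved from the restricted Lebesgue measure to \<open>lborel\<close> and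
  a closed interval, where the fundamental theorem applies; the end points are null sets.\<close>

lemma tail_int_FTC:
  assumes "t \<in> {0..T}" and deriv: "\<And>s. (\<phi> has_real_derivative \<phi>' s) (at s)"
    and cont: "continuous_on UNIV \<phi>'"
  shows "tail_int T \<phi>' t = \<phi> T - \<phi> t"
proof -
  have [measurable]: "\<phi>' \<in> borel_measurable borel"
    using cont by (rule borel_measurable_continuous_onI)
  have "tail_int T \<phi>' t = (LINT s|lebesgue. indicator {0<..<T} s *\<^sub>R (indicator {t<..} s * \<phi>' s))"
    unfolding tail_int_def by (rule integral_restrict_space) simp
  also have "\<dots> = (LINT s|lborel. indicator {0<..<T} s *\<^sub>R (indicator {t<..} s * \<phi>' s))"
    by (rule integral_completion) measurable
  also have "\<dots> = (LINT s|lborel. indicator {t..T} s *\<^sub>R \<phi>' s)"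
  proof (rule integral_cong_AE)
    show "AE s in lborel. indicator {0<..<T} s *\<^sub>R (indicator {t<..} s * \<phi>' s) =
        indicator {t..T} s *\<^sub>R \<phi>' s"
      using AE_lborel_singleton[of t] AE_lborel_singleton[of T]
      by eventually_elim (use \<open>t \<in> {0..T}\<close> in \<open>auto simp: indicator_def\<close>)
  qed measurable
  also have "\<dots> = \<phi> T - \<phi> t"
    by (rule integral_FTC_atLeastAtMost)
      (use assms in \<open>auto simp: has_real_derivative_iff_has_vector_derivative
        intro: has_vector_derivative_at_within continuous_on_subset\<close>)
  finally show ?thesis .
qed

text \<open>Integration by parts by Fubini: the product of the two total integrals is a double
  integral over a square, which the diagonal cuts into two triangles. With \<open>q = r\<close> it
  is the energy identity, and with the derivative of a test function it yields weak
  derivatives.\<close>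

lemma tail_int_product:
  assumes r: "integrable (time_measure T) r" and q: "integrable (time_measure T) q"
  shows "(LINT t|time_measure T. r t * tail_int T q t) + (LINT t|time_measure T. q t * tail_int T r t) =
    tail_int T r 0 * tail_int T q 0"
proof -
  let ?N = "time_measure T"
  interpret N: finite_measure ?N by (rule finite_time_measure)
  interpret NN: pair_sigma_finite ?N ?N ..
  have [measurable]: "r \<in> borel_measurable ?N" "q \<in> borel_measurable ?N"
    using r q by auto
  have [measurable]: "(\<lambda>t. t) \<in> borel_measurable ?N"
    by (rule time_measure_borel_measurable) simp
  have prod: "integrable (?N \<Otimes>\<^sub>M ?N) (\<lambda>(t, s). r t * q s)"
    by (rule NN.Fubini_integrable)
      (use r q in \<open>auto simp: abs_mult intro!: integrable_mult_right integrable_abs\<close>)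
  have ind: "integrable (?N \<Otimes>\<^sub>M ?N) (\<lambda>(t, s). (if P t s then 1 else 0) * (r t * q s))"
    if [measurable]: "Measurable.pred (?N \<Otimes>\<^sub>M ?N) (\<lambda>(t, s). P t s)" for P
    by (rule Bochner_Integration.integrable_bound[OF prod]) (measurable, auto)
  have lt: "Measurable.pred (?N \<Otimes>\<^sub>M ?N) (\<lambda>(t, s). t < s)"
    "Measurable.pred (?N \<Otimes>\<^sub>M ?N) (\<lambda>(t, s). s < t)"
    by measurable
  have zero: "tail_int T p 0 = (LINT s|?N. p s)" for p
    unfolding tail_int_def by (rule Bochner_Integration.integral_cong) (auto simp: space_restrict_space)
  have 1: "(LINT t|?N. r t * tail_int T q t) =
      (LINT t|?N. LINT s|?N. (if t < s then 1 else 0) * (r t * q s))"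
    unfolding tail_int_def Bochner_Integration.integral_mult_right_zero[symmetric]
    by (intro Bochner_Integration.integral_cong) (auto simp: indicator_def)
  have "(LINT s|?N. q s * tail_int T r s) =
      (LINT s|?N. LINT t|?N. (if s < t then 1 else 0) * (r t * q s))"
    unfolding tail_int_def Bochner_Integration.integral_mult_right_zero[symmetric]
    by (intro Bochner_Integration.integral_cong) (auto simp: indicator_def)
  \<comment> \<open>After the exchange both inner integrals run over \<open>s\<close> for fixed
    \<open>t\<close> and can be added pointwise in \<open>t\<close>.\<close>
  also have "\<dots> = (LINT t|?N. LINT s|?N. (if s < t then 1 else 0) * (r t * q s))"
    by (rule NN.Fubini_integral[OF ind[OF lt(2)]])
  finally have 2: "(LINT t|?N. q t * tail_int T r t) = \<dots>" .
  have "(LINT t|?N. r t * tail_int T q t) + (LINT t|?N. q t * tail_int T r t) =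
      (LINT t|?N. (LINT s|?N. (if t < s then 1 else 0) * (r t * q s)) +
                  (LINT s|?N. (if s < t then 1 else 0) * (r t * q s)))"
    unfolding 1 2
    using NN.integrable_fst[OF ind[OF lt(1)]] NN.integrable_fst[OF ind[OF lt(2)]]
    by simp
  also have "\<dots> = (LINT t|?N. r t * (LINT s|?N. q s))"
  proof (intro Bochner_Integration.integral_cong refl)
    fix t
    have "integrable ?N (\<lambda>s. (if t < s then 1 else 0) * (r t * q s))"
      "integrable ?N (\<lambda>s. (if s < t then 1 else 0) * (r t * q s))"
      by (rule Bochner_Integration.integrable_bound[of _ "\<lambda>s. r t * q s"], use q in auto)+
    then have "(LINT s|?N. (if t < s then 1 else 0) * (r t * q s)) +
        (LINT s|?N. (if s < t then 1 else 0) * (r t * q s)) =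
        (LINT s|?N. (if t < s then 1 else 0) * (r t * q s) + (if s < t then 1 else 0) * (r t * q s))"
      by simp
    also have "\<dots> = (LINT s|?N. r t * q s)"
      proof (rule integral_cong_AE)
      \<comment> \<open>For fixed \<open>t\<close> the two triangles miss only the point of the
        diagonal.\<close>
      show "AE s in ?N. (if t < s then 1 else 0) * (r t * q s) + (if s < t then 1 else 0) * (r t * q s) =
          r t * q s"
        using AE_time_measure_neq[of t] by eventually_elim auto
    qed measurable
    finally show "(LINT s|?N. (if t < s then 1 else 0) * (r t * q s)) +
        (LINT s|?N. (if s < t then 1 else 0) * (r t * q s)) = r t * (LINT s|?N. q s)"
      by simp
  qed
  finally show ?thesis
    by (simp add: zero)
qed

section \<open>Weak derivatives\<close>

text \<open>Squaring removes the kink at 0, where the difference quotient is at most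
  \<open>\<bar>h\<bar>\<close>. Products of such functions give C1 bumps supported on an
  interval.\<close>

lemma has_real_derivative_pos_square:
  fixes x :: real
  shows "((\<lambda>x. (max 0 x)\<^sup>2) has_real_derivative 2 * max 0 x) (at x)"
proof -
  consider "x < 0" | "x = 0" | "0 < x" by linarith
  then show ?thesis
  proof cases
    case 1
    have "((\<lambda>x. 0) has_real_derivative 0) (at x)" by simp
    then have "((\<lambda>x. (max 0 x)\<^sup>2) has_real_derivative 0) (at x)"
      by (rule DERIV_cong_ev[THEN iffD1, rotated -1])
        (use 1 order_tendstoD(2)[OF tendsto_ident_at 1, of UNIV] in
          \<open>auto intro!: eventually_mono[OF eventually_nhds_in_open[of "{..<0}" x]]\<close>)
    then show ?thesis using 1 by simp
  next
    case 2
    have "((\<lambda>h::real. (max 0 h)\<^sup>2 / h) \<longlongrightarrow> 0) (at 0)"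
    proof (rule Lim_null_comparison)
      show "\<forall>\<^sub>F h in at 0. norm ((max 0 h)\<^sup>2 / h) \<le> \<bar>h\<bar>"
        by (intro always_eventually) (auto simp: max_def power2_eq_square)
      show "((\<lambda>h::real. \<bar>h\<bar>) \<longlongrightarrow> 0) (at 0)"
        using tendsto_rabs[OF tendsto_ident_at[of "0::real" UNIV]] by simp
    qed
    then show ?thesis
      using 2 by (simp add: has_field_derivative_iff)
  next
    case 3
    have "((\<lambda>x. x\<^sup>2) has_real_derivative 2 * x) (at x)"
      by (auto intro!: derivative_eq_intros)
    then have "((\<lambda>x. (max 0 x)\<^sup>2) has_real_derivative 2 * x) (at x)"
      by (rule DERIV_cong_ev[THEN iffD1, rotated -1])
        (use 3 in \<open>auto intro!: eventually_mono[OF eventually_nhds_in_open[of "{0<..}" x]]\<close>)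
    then show ?thesis using 3 by simp
  qed
qed

text \<open>The bumps \<open>n \<psi> / (1 + n \<psi>)\<close>, where \<open>\<psi>\<close> is \<open>C\<^sup>1\<close> and positive exactly on the interval, increase
  to its indicator function.\<close>

lemma indicator_interval_C1_approx:
  fixes a b :: real
  obtains \<phi> \<phi>' :: "nat \<Rightarrow> real \<Rightarrow> real" where
    "\<And>n t. (\<phi> n has_real_derivative \<phi>' n t) (at t)" "\<And>n. continuous_on UNIV (\<phi>' n)"
    "\<And>n t. t \<notin> {a..b} \<Longrightarrow> \<phi> n t = 0" "\<And>n t. \<bar>\<phi> n t\<bar> \<le> 1"
    "\<And>t. (\<lambda>n. \<phi> n t) \<longlonglongrightarrow> indicator {a<..<b} t"
proof -
  define \<psi> where "\<psi> t = (max 0 (t - a))\<^sup>2 * (max 0 (b - t))\<^sup>2" for t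
  define \<psi>' where "\<psi>' t = 2 * max 0 (t - a) * (max 0 (b - t))\<^sup>2 -
    (max 0 (t - a))\<^sup>2 * (2 * max 0 (b - t))" for t
  define \<phi> where "\<phi> n t = real n * \<psi> t / (1 + real n * \<psi> t)" for n t
  define \<phi>' where "\<phi>' n t = real n * \<psi>' t / (1 + real n * \<psi> t)\<^sup>2" for n t
  have \<psi>0: "0 \<le> \<psi> t" for t
    unfolding \<psi>_def by simp
  have pos: "0 < 1 + real n * \<psi> t" for n t
    using \<psi>0[of t] by (simp add: add_pos_nonneg)
  have d\<psi>: "(\<psi> has_real_derivative \<psi>' t) (at t)" for t
  proof -
    have 1: "((\<lambda>t. (max 0 (t - a))\<^sup>2) has_real_derivative 2 * max 0 (t - a) * 1) (at t)"
      by (rule DERIV_chain2[OF has_real_derivative_pos_square]) (auto intro!: derivative_eq_intros)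
    have 2: "((\<lambda>t. (max 0 (b - t))\<^sup>2) has_real_derivative 2 * max 0 (b - t) * (- 1)) (at t)"
      by (rule DERIV_chain2[OF has_real_derivative_pos_square]) (auto intro!: derivative_eq_intros)
    show ?thesis
      unfolding \<psi>_def[abs_def] \<psi>'_def
      by (rule DERIV_cong[OF DERIV_mult[OF 1 2]]) simp
  qed
  show ?thesis
  proof (rule that[of \<phi> \<phi>'])
    fix n t
    have "((\<lambda>t. real n * \<psi> t) has_real_derivative real n * \<psi>' t) (at t)"
      by (rule DERIV_cmult[OF d\<psi>])
    moreover from this have "((\<lambda>t. 1 + real n * \<psi> t) has_real_derivative real n * \<psi>' t) (at t)"
      using DERIV_add[OF DERIV_const[of 1]] by fastforce
    ultimately have "((\<lambda>t. real n * \<psi> t / (1 + real n * \<psi> t)) has_real_derivative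
        (real n * \<psi>' t * (1 + real n * \<psi> t) - real n * \<psi> t * (real n * \<psi>' t)) /
        ((1 + real n * \<psi> t) * (1 + real n * \<psi> t))) (at t)"
      by (rule DERIV_divide) (use pos[of n t] in simp)
    then show "(\<phi> n has_real_derivative \<phi>' n t) (at t)"
      unfolding \<phi>_def[abs_def] \<phi>'_def by (simp add: algebra_simps power2_eq_square)
  next
    fix n
    have "1 + real n * \<psi> t \<noteq> 0" for t
      using pos[of n t] by simp
    then have "\<forall>t\<in>UNIV. (1 + real n * \<psi> t)\<^sup>2 \<noteq> 0"
      by simp
    then show "continuous_on UNIV (\<phi>' n)"
      unfolding \<phi>'_def[abs_def] \<psi>'_def[abs_def] \<psi>_def[abs_def]
      by (intro continuous_intros)
  next
    fix n t assume "t \<notin> {a..b}"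
    then show "\<phi> n t = 0"
      by (auto simp: \<phi>_def \<psi>_def max_def)
  next
    fix n t
    show "\<bar>\<phi> n t\<bar> \<le> 1"
      using \<psi>0[of t] pos[of n t] by (simp add: \<phi>_def)
  next
    fix t
    show "(\<lambda>n. \<phi> n t) \<longlonglongrightarrow> indicator {a<..<b} t"
    proof (cases "t \<in> {a<..<b}")
      case True
      then have p: "0 < \<psi> t"
        by (simp add: \<psi>_def)
      have "(\<lambda>n. 1 - 1 / (1 + real n * \<psi> t)) \<longlonglongrightarrow> 1 - 0"
        by (intro tendsto_diff tendsto_const tendsto_divide_0[OF tendsto_const]
            filterlim_at_top_imp_at_infinity
            filterlim_tendsto_add_at_top[OF tendsto_const] filterlim_at_top_mult_tendsto_pos[OF tendsto_const p]
            filterlim_real_sequentially)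
      moreover have "1 - 1 / (1 + real n * \<psi> t) = \<phi> n t" for n
        using pos[of n t] unfolding \<phi>_def by (simp add: field_simps)
      ultimately show ?thesis
        using True by simp
    next
      case False
      then have "\<psi> t = 0"
        by (auto simp: \<psi>_def)
      then show ?thesis
        using False by (simp add: \<phi>_def)
    qed
  qed
qed

section \<open>The fundamental lemma of the calculus of variations\<close>

text \<open>Open intervals are an intersection-stable generator of the Borel sets, so a Dynkin class
  argument extends the vanishing to Borel sets, and completion extends it to Lebesgue sets. A
  function whose integral over every measurable set is 0 vanishes almost everywhere.\<close>

lemma AE_zero_of_interval_integrals_zero:
  fixes g :: "real \<Rightarrow> 'e::{banach,second_countable_topology}"
  assumes g: "integrable (time_measure T) g"
    and zero: "\<And>a b. set_lebesgue_integral (time_measure T) {a<..<b} g = 0"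
  shows "AE t in time_measure T. g t = 0"
proof -
  let ?N = "time_measure T"
  interpret N: finite_measure ?N by (rule finite_time_measure)
  \<comment> \<open>The measurable sets of \<open>?N\<close> lie inside the time interval, so the
    induction concerns traces of Borel sets.\<close>
  have borel_sets: "B \<inter> {0<..<T} \<in> sets ?N" if "B \<in> sets borel" for B
    unfolding sets_restrict_space by (rule image_eqI[of _ _ B]) (use that in auto)
  have sub: "set_lebesgue_integral ?N B g = set_lebesgue_integral ?N (B \<inter> {0<..<T}) g" for B
    unfolding set_lebesgue_integral_def
    by (rule Bochner_Integration.integral_cong) (auto simp: space_restrict_space indicator_def)
  have si: "set_integrable ?N (B \<inter> {0<..<T}) g" if "B \<in> sets borel" for B
    unfolding set_integrable_def
    by (rule integrable_mult_indicator[OF borel_sets[OF that] g])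
  have gen: "sets borel = sigma_sets UNIV (range (\<lambda>(a, b::real). {a<..<b}))"
    by (subst borel_eq_box) (simp add: case_prod_unfold box_real)
  have borel: "set_lebesgue_integral ?N (B \<inter> {0<..<T}) g = 0" if "B \<in> sets borel" for B
  proof -
    let ?G = "range (\<lambda>(a, b::real). {a<..<b})"
    have "Int_stable ?G"
      by (auto simp: Int_stable_def Int_greaterThanLessThan intro!: image_eqI)
    moreover have "?G \<subseteq> Pow UNIV"
      by simp
    moreover have "B \<in> sigma_sets UNIV ?G"
      using that gen by simp
    ultimately show ?thesis
    proof (induction rule: sigma_sets_induct_disjoint)
      case (basic A)
      then show ?case using zero sub by auto
    next
      case (compl A)
      then have A: "A \<in> sets borel" by (simp add: gen)
      have "set_lebesgue_integral ?N (A \<inter> {0<..<T} \<union> (UNIV - A) \<inter> {0<..<T}) g =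
          set_lebesgue_integral ?N (A \<inter> {0<..<T}) g +
          set_lebesgue_integral ?N ((UNIV - A) \<inter> {0<..<T}) g"
        by (rule set_integral_Un) (use si A in auto)
      moreover have "A \<inter> {0<..<T} \<union> (UNIV - A) \<inter> {0<..<T} = {0<..<T}"
        by auto
      ultimately show ?case
        using zero[of 0 T] compl by simp
    next
      case (union A)
      then have "range A \<subseteq> sets borel" by (simp only: gen)
      then have A: "A n \<in> sets borel" for n by blast
      have "set_lebesgue_integral ?N (\<Union>n. A n \<inter> {0<..<T}) g =
          (\<Sum>n. set_lebesgue_integral ?N (A n \<inter> {0<..<T}) g)"
      proof (rule lebesgue_integral_countable_add)
        have "(\<Union>n. A n \<inter> {0<..<T}) = (\<Union>n. A n) \<inter> {0<..<T}" by auto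
        then show "set_integrable ?N (\<Union>n. A n \<inter> {0<..<T}) g"
          using si[of "\<Union>n. A n"] A by simp
      qed (use A union borel_sets in \<open>auto simp: disjoint_family_on_def\<close>)
      moreover have "(\<Union>n. A n \<inter> {0<..<T}) = (\<Union>n. A n) \<inter> {0<..<T}" by auto
      ultimately show ?case
        using union by simp
    qed (simp_all add: set_lebesgue_integral_def)
  qed
  \<comment> \<open>A Lebesgue set differs from a Borel set only within a null set, which leaves the
    integral unchanged.\<close>
  have "set_lebesgue_integral ?N A g = 0" if A: "A \<in> sets ?N" for A
  proof -
    from A obtain B where "B \<in> sets lebesgue" "A = B \<inter> {0<..<T}"
      by (auto simp: sets_restrict_space)
    then obtain S N N' where S: "B = S \<union> N" "N \<subseteq> N'" "N' \<in> null_sets lborel" "S \<in> sets lborel"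
      by (auto elim: sets_completionE)
    have "AE t in lebesgue. t \<notin> N'"
      by (intro AE_completion AE_not_in S)
    then have "AE t in ?N. t \<notin> N'"
      by (auto simp: AE_restrict_space_iff)
    then have "AE t in ?N. indicator A t *\<^sub>R g t = indicator (S \<inter> {0<..<T}) t *\<^sub>R g t"
      by eventually_elim (use S \<open>A = _\<close> in \<open>auto simp: indicator_def\<close>)
    then have "set_lebesgue_integral ?N A g = set_lebesgue_integral ?N (S \<inter> {0<..<T}) g"
      unfolding set_lebesgue_integral_def
      using A borel_sets[of S] S(4) g by (intro integral_cong_AE) auto
    then show ?thesis
      using borel S(4) by simp
  qed
  then show ?thesis
    by (rule N.density_zero[OF g])
qed

text \<open>Bumps converge boundedly to the indicator of an interval, so vanishing test integrals
  force vanishing interval integrals.\<close>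

lemma AE_zero_of_test_integrals_zero:
  fixes g :: "real \<Rightarrow> 'e::{banach,second_countable_topology}"
  assumes g: "integrable (time_measure T) g"
    and test: "\<And>\<phi> \<phi>' a b. \<lbrakk>0 < a; b < T; \<And>t. t \<notin> {a..b} \<Longrightarrow> \<phi> t = 0;
        \<And>t. (\<phi> has_real_derivative \<phi>' t) (at t); continuous_on UNIV \<phi>'\<rbrakk> \<Longrightarrow>
        (LINT t|time_measure T. \<phi> t *\<^sub>R g t) = 0"
  shows "AE t in time_measure T. g t = 0"
proof (rule AE_zero_of_interval_integrals_zero[OF g])
  let ?N = "time_measure T"
  have ind [measurable]: "(indicator {a<..<b} :: real \<Rightarrow> real) \<in> borel_measurable ?N" for a b
    by (rule time_measure_borel_measurable) simp
  have inner: "set_lebesgue_integral ?N {a<..<b} g = 0" if "0 < a" "b < T" for a b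
  proof -
    obtain \<phi> \<phi>' where \<phi>: "\<And>n t. (\<phi> n has_real_derivative \<phi>' n t) (at t)"
      "\<And>n. continuous_on UNIV (\<phi>' n)"
      "\<And>n t. t \<notin> {a..b} \<Longrightarrow> \<phi> n t = (0::real)" "\<And>n t. \<bar>\<phi> n t\<bar> \<le> 1"
      "\<And>t. (\<lambda>n::nat. \<phi> n t) \<longlonglongrightarrow> indicator {a<..<b} t"
      apply (rule indicator_interval_C1_approx[of a b])
      subgoal for \<phi> \<phi>' by (rule that[of \<phi> \<phi>'])
      done
    have [measurable]: "\<phi> n \<in> borel_measurable ?N" for n
      using \<phi>(1)[of n] by (intro time_measure_borel_measurable borel_measurable_continuous_onI
          DERIV_continuous_on[of _ _ "\<phi>' n"])
    have "(\<lambda>n. LINT t|?N. \<phi> n t *\<^sub>R g t) \<longlonglongrightarrow> (LINT t|?N. indicator {a<..<b} t *\<^sub>R g t)"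
    proof (rule integral_dominated_convergence[where w = "\<lambda>t. norm (g t)"])
      show "AE t in ?N. (\<lambda>n. \<phi> n t *\<^sub>R g t) \<longlonglongrightarrow> indicator {a<..<b} t *\<^sub>R g t"
        by (intro AE_I2 tendsto_intros \<phi>(5))
      show "AE t in ?N. norm (\<phi> n t *\<^sub>R g t) \<le> norm (g t)" for n
        using \<phi>(4) by (auto simp: mult_left_le_one_le)
    qed (use g in auto)
    moreover have "(LINT t|?N. \<phi> n t *\<^sub>R g t) = 0" for n
      using that \<phi> by (intro test[of a b "\<phi> n" "\<phi>' n"]) auto
    ultimately show ?thesis
      unfolding set_lebesgue_integral_def by (simp add: LIMSEQ_const_iff)
  qed
  fix a b
  \<comment> \<open>Test functions must vanish near 0 and \<open>T\<close>, so \<open>inner\<close>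
    reaches only intervals away from both. A general interval is exhausted by cutting it off at
    distance \<open>1 / real (Suc n)\<close> from the two ends.\<close>
  define a' b' where "a' n = max a (1 / real (Suc n))" and "b' n = min b (T - 1 / real (Suc n))" for n
  have "(\<lambda>n. LINT t|?N. indicator {a' n<..<b' n} t *\<^sub>R g t) \<longlonglongrightarrow>
      (LINT t|?N. indicator {a<..<b} t *\<^sub>R g t)"
  proof (rule integral_dominated_convergence[where w = "\<lambda>t. norm (g t)"])
    show "AE t in ?N. (\<lambda>n. indicator {a' n<..<b' n} t *\<^sub>R g t) \<longlonglongrightarrow> indicator {a<..<b} t *\<^sub>R g t"
    proof (rule AE_I2)
      fix t assume "t \<in> space ?N"
      then have t: "0 < t" "0 < T - t"
        by (auto simp: space_restrict_space)
      have lim: "(\<lambda>n. 1 / real (Suc n)) \<longlonglongrightarrow> 0"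
        by (intro LIMSEQ_Suc lim_1_over_n)
      have "\<forall>\<^sub>F n in sequentially. indicator {a' n<..<b' n} t = (indicator {a<..<b} t :: real)"
        using order_tendstoD(2)[OF lim t(1)] order_tendstoD(2)[OF lim t(2)]
        by eventually_elim (auto simp: indicator_def a'_def b'_def)
      then show "(\<lambda>n. indicator {a' n<..<b' n} t *\<^sub>R g t) \<longlonglongrightarrow> indicator {a<..<b} t *\<^sub>R g t"
        by (intro tendsto_scaleR tendsto_const tendsto_eventually)
    qed
    show "AE t in ?N. norm (indicator {a' n<..<b' n} t *\<^sub>R g t) \<le> norm (g t)" for n
      by (simp add: indicator_def)
  qed (use g in auto)
  moreover have "(LINT t|?N. indicator {a' n<..<b' n} t *\<^sub>R g t) = 0" for n
    using inner[of "a' n" "b' n"] unfolding set_lebesgue_integral_def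
    by (simp add: a'_def b'_def less_max_iff_disj min_less_iff_disj)
  ultimately show "set_lebesgue_integral ?N {a<..<b} g = 0"
    unfolding set_lebesgue_integral_def by (simp add: LIMSEQ_const_iff)
qed

section \<open>Uniqueness and calculus of weak derivatives\<close>

lemma Lsq_integrable:
  fixes x :: "real \<Rightarrow> 'e::{banach,second_countable_topology}"
  assumes "x \<in> Lsq T"
  shows "integrable (time_measure T) x"
proof -
  interpret finite_measure "time_measure T" by (rule finite_time_measure)
  show ?thesis
  proof (rule Bochner_Integration.integrable_bound)
    show "integrable (time_measure T) (\<lambda>t. 1 + (norm (x t))\<^sup>2)"
      using assms by (simp add: Lsq_def)
    have "y \<le> 1 + y\<^sup>2" for y :: real
    proof -
      have "2 * y \<le> y\<^sup>2 + 1"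
        using sum_squares_bound[of y 1] by simp
      then show ?thesis
        using zero_le_power2[of y] by linarith
    qed
    then show "AE t in time_measure T. norm (x t) \<le> norm (1 + (norm (x t))\<^sup>2)"
      by simp
  qed (use assms in \<open>simp add: Lsq_def\<close>)
qed

lemma weak_derivD:
  assumes "weak_deriv T x g" and "0 < a" "b < T" "\<And>t. t \<notin> {a..b} \<Longrightarrow> \<phi> t = 0"
    "\<And>t. (\<phi> has_real_derivative \<phi>' t) (at t)" "continuous_on UNIV \<phi>'"
  shows "(LINT t|time_measure T. \<phi>' t *\<^sub>R x t) = - (LINT t|time_measure T. \<phi> t *\<^sub>R g t)"
  by (rule assms(1)[unfolded weak_deriv_def, rule_format, of a b \<phi> \<phi>']) (use assms in simp)

text \<open>The difference integrates to 0 against every test function. Hence the choice in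
  \<open>time_deriv\<close> is harmless: it agrees almost everywhere with any explicit derivative in
  \<open>Lsq T\<close>.\<close>

lemma weak_deriv_unique:
  assumes "g \<in> Lsq T" "g' \<in> Lsq T" "weak_deriv T x g" "weak_deriv T x g'"
  shows "AE t in time_measure T. g t = g' t"
proof -
  note int = Lsq_integrable[OF assms(1)] Lsq_integrable[OF assms(2)]
  have "AE t in time_measure T. g t - g' t = 0"
  proof (rule AE_zero_of_test_integrals_zero)
    fix \<phi> \<phi>' :: "real \<Rightarrow> real" and a b
    assume *: "0 < a" "b < T" "\<And>t. t \<notin> {a..b} \<Longrightarrow> \<phi> t = 0"
      and d: "\<And>t. (\<phi> has_real_derivative \<phi>' t) (at t)" and "continuous_on UNIV \<phi>'"
    then have eq: "(LINT t|time_measure T. \<phi> t *\<^sub>R g t) = (LINT t|time_measure T. \<phi> t *\<^sub>R g' t)"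
      using weak_derivD[OF assms(3), of a b \<phi> \<phi>'] weak_derivD[OF assms(4), of a b \<phi> \<phi>'] by simp
    have cont: "continuous_on UNIV \<phi>"
      using d by (meson DERIV_continuous_on has_field_derivative_at_within)
    show "(LINT t|time_measure T. \<phi> t *\<^sub>R (g t - g' t)) = 0"
      using int[THEN integrable_continuous_scaleR[OF cont]] eq by (simp add: scaleR_diff_right)
  qed (use int in auto)
  then show ?thesis by simp
qed

lemma time_deriv:
  fixes \<iota> :: "'v::{real_inner,banach,second_countable_topology} \<Rightarrow>\<^sub>L 'h::real_inner"
  assumes "x \<in> X_space T \<iota>"
  shows "time_deriv T \<iota> x \<in> Lsq T" "weak_deriv T (\<lambda>t. to_dual \<iota> (x t)) (time_deriv T \<iota> x)"
proof -
  have "\<exists>g. g \<in> Lsq T \<and> weak_deriv T (\<lambda>t. to_dual \<iota> (x t)) g"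
    using assms by (auto simp: X_space_def)
  from someI_ex[OF this]
  show "time_deriv T \<iota> x \<in> Lsq T" "weak_deriv T (\<lambda>t. to_dual \<iota> (x t)) (time_deriv T \<iota> x)"
    by (simp_all add: time_deriv_def)
qed

text \<open>Bounded linear maps commute with the Bochner integral. This serves to attach basis
  vectors to scalar coefficients and to pass from V to its dual.\<close>

lemma weak_deriv_bounded_linear:
  assumes B: "bounded_linear B" and "weak_deriv T x g"
    and x: "integrable (time_measure T) x" and g: "integrable (time_measure T) g"
  shows "weak_deriv T (\<lambda>t. B (x t)) (\<lambda>t. B (g t))"
  unfolding weak_deriv_def
proof (intro allI impI)
  fix \<phi> \<phi>' :: "real \<Rightarrow> real" and a b
  assume *: "0 < a \<and> b < T \<and> (\<forall>t. t \<notin> {a..b} \<longrightarrow> \<phi> t = 0) \<and>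
    (\<forall>t. (\<phi> has_real_derivative \<phi>' t) (at t)) \<and> continuous_on UNIV \<phi>'"
  then have "continuous_on UNIV \<phi>'" "continuous_on UNIV \<phi>"
    by (auto intro: DERIV_continuous_on[of UNIV \<phi> \<phi>'] has_field_derivative_at_within)
  note int = integrable_continuous_scaleR[OF this(1) x] integrable_continuous_scaleR[OF this(2) g]
  note lin = bounded_linear.linear[OF B]
  have "(LINT t|time_measure T. \<phi>' t *\<^sub>R B (x t)) = B (LINT t|time_measure T. \<phi>' t *\<^sub>R x t)"
    using integral_bounded_linear[OF B int(1)] by (simp add: linear_cmul[OF lin])
  also have "(LINT t|time_measure T. \<phi>' t *\<^sub>R x t) = - (LINT t|time_measure T. \<phi> t *\<^sub>R g t)"
    by (rule weak_derivD[OF assms(2), of a b]) (use * in auto)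
  also have "B (- (LINT t|time_measure T. \<phi> t *\<^sub>R g t)) = - (LINT t|time_measure T. \<phi> t *\<^sub>R B (g t))"
    using integral_bounded_linear[OF B int(2)] by (simp add: linear_cmul[OF lin] linear_neg[OF lin])
  finally show "(LINT t|time_measure T. \<phi>' t *\<^sub>R B (x t)) = - (LINT t|time_measure T. \<phi> t *\<^sub>R B (g t))" .
qed

text \<open>Integration by parts against \<open>\<phi>'\<close>, whose tail integral is
  \<open>- \<phi> t\<close> because \<open>\<phi>\<close> vanishes at \<open>T\<close>; the boundary
  term disappears because \<open>\<phi>\<close> vanishes at 0.\<close>

lemma weak_deriv_tail_int:
  assumes p: "integrable (time_measure T) p"
  shows "weak_deriv T (tail_int T p) (\<lambda>t. - p t)"
  unfolding weak_deriv_def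
proof (intro allI impI)
  let ?N = "time_measure T"
  fix \<phi> \<phi>' :: "real \<Rightarrow> real" and a b
  assume *: "0 < a \<and> b < T \<and> (\<forall>t. t \<notin> {a..b} \<longrightarrow> \<phi> t = 0) \<and>
    (\<forall>t. (\<phi> has_real_derivative \<phi>' t) (at t)) \<and> continuous_on UNIV \<phi>'"
  show "(LINT t|?N. \<phi>' t *\<^sub>R tail_int T p t) = - (LINT t|?N. \<phi> t *\<^sub>R - p t)"
  proof (cases "0 < T")
    case True
    have \<phi>: "tail_int T \<phi>' t = - \<phi> t" if "t \<in> {0..T}" for t
      using tail_int_FTC[OF that, of \<phi> \<phi>'] * by auto
    have "(LINT t|?N. \<phi>' t * tail_int T p t) + (LINT t|?N. p t * tail_int T \<phi>' t) =
        tail_int T \<phi>' 0 * tail_int T p 0"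
      using * by (intro tail_int_product integrable_continuous_time p) auto
    also have "\<dots> = 0"
      using \<phi>[of 0] True * by auto
    also have "(LINT t|?N. p t * tail_int T \<phi>' t) = (LINT t|?N. - (\<phi> t * p t))"
      by (rule Bochner_Integration.integral_cong) (auto simp: space_restrict_space \<phi>)
    finally show ?thesis
      by simp
  next
    case False
    then have [simp]: "{0<..<T} = {}" by auto
    have "(LINT t|?N. g t) = 0" for g :: "real \<Rightarrow> real"
      by (subst Bochner_Integration.integral_cong[where g = "\<lambda>_. 0"]) (auto simp: space_restrict_space)
    then show ?thesis by simp
  qed
qed

lemma weak_deriv_sum:
  assumes "finite E" and wd: "\<And>e. e \<in> E \<Longrightarrow> weak_deriv T (x e) (g e)"
    and x: "\<And>e. e \<in> E \<Longrightarrow> integrable (time_measure T) (x e)"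
    and g: "\<And>e. e \<in> E \<Longrightarrow> integrable (time_measure T) (g e)"
  shows "weak_deriv T (\<lambda>t. \<Sum>e\<in>E. x e t) (\<lambda>t. \<Sum>e\<in>E. g e t)"
  unfolding weak_deriv_def
proof (intro allI impI)
  let ?N = "time_measure T"
  fix \<phi> \<phi>' :: "real \<Rightarrow> real" and a b
  assume *: "0 < a \<and> b < T \<and> (\<forall>t. t \<notin> {a..b} \<longrightarrow> \<phi> t = 0) \<and>
    (\<forall>t. (\<phi> has_real_derivative \<phi>' t) (at t)) \<and> continuous_on UNIV \<phi>'"
  then have c: "continuous_on UNIV \<phi>'" "continuous_on UNIV \<phi>"
    by (auto intro: DERIV_continuous_on[of UNIV \<phi> \<phi>'] has_field_derivative_at_within)
  have "(LINT t|?N. \<phi>' t *\<^sub>R (\<Sum>e\<in>E. x e t)) = (\<Sum>e\<in>E. LINT t|?N. \<phi>' t *\<^sub>R x e t)"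
    unfolding scaleR_sum_right
    by (rule Bochner_Integration.integral_sum) (rule integrable_continuous_scaleR[OF c(1) x])
  also have "\<dots> = (\<Sum>e\<in>E. - (LINT t|?N. \<phi> t *\<^sub>R g e t))"
    by (intro sum.cong refl weak_derivD[OF wd, of _ a b]) (use * in auto)
  also have "\<dots> = - (LINT t|?N. \<phi> t *\<^sub>R (\<Sum>e\<in>E. g e t))"
    unfolding scaleR_sum_right
    by (subst Bochner_Integration.integral_sum) (auto intro: integrable_continuous_scaleR[OF c(2) g] simp: sum_negf)
  finally show "(LINT t|?N. \<phi>' t *\<^sub>R (\<Sum>e\<in>E. x e t)) = - (LINT t|?N. \<phi> t *\<^sub>R (\<Sum>e\<in>E. g e t))" .
qed

lemma weak_deriv_cong:
  assumes "weak_deriv T x g" and "\<And>t. t \<in> {0<..<T} \<Longrightarrow> x t = y t"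
  shows "weak_deriv T y g"
proof -
  have "(LINT t|time_measure T. \<phi>' t *\<^sub>R x t) = (LINT t|time_measure T. \<phi>' t *\<^sub>R y t)" for \<phi>'
    by (rule Bochner_Integration.integral_cong) (auto simp: space_restrict_space assms(2))
  then show ?thesis
    using assms(1) by (simp add: weak_deriv_def)
qed

section \<open>Continuous representatives and point values\<close>

text \<open>The set of disagreement inside the interval is open and negligible, hence empty;
  continuity settles the end points.\<close>

lemma continuous_AE_eq_imp_eq:
  fixes g h :: "real \<Rightarrow> 'e::real_normed_vector"
  assumes "0 < T" and g: "continuous_on {0..T} g" and h: "continuous_on {0..T} h"
    and ae: "AE t in time_measure T. g t = h t" and s: "s \<in> {0..T}"
  shows "g s = h s"
proof -
  define D where "D = {t \<in> {0<..<T}. g t - h t \<in> - {0}}"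
  have "open ({0<..<T} \<inter> (\<lambda>t. g t - h t) -` (- {0}))"
    by (intro continuous_open_preimage continuous_intros continuous_on_subset[OF g]
        continuous_on_subset[OF h]) auto
  then have "open D"
    by (simp add: D_def Int_def vimage_def)
  moreover have "negligible D"
  proof -
    have "AE t in lebesgue. t \<in> {0<..<T} \<longrightarrow> g t = h t"
      using ae by (subst (asm) AE_restrict_space_iff) auto
    then have "AE t in lebesgue. t \<notin> D"
      by eventually_elim (auto simp: D_def)
    moreover have "D \<in> sets lebesgue"
      using \<open>open D\<close> by auto
    ultimately show ?thesis
      by (simp add: negligible_iff_null_sets AE_iff_null_sets)
  qed
  ultimately have "D = {}"
    using open_not_negligible by blast
  have "g s - h s = 0"
  proof (rule continuous_constant_on_closure[where f = "\<lambda>t. g t - h t" and S = "{0<..<T}"])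
    show "continuous_on (closure {0<..<T}) (\<lambda>t. g t - h t)"
      using \<open>0 < T\<close> by (auto intro!: continuous_intros g h)
    show "g t - h t = 0" if "t \<in> {0<..<T}" for t
      using \<open>D = {}\<close> that by (auto simp: D_def)
  qed (use \<open>0 < T\<close> s in auto)
  then show ?thesis by simp
qed

text \<open>Uniqueness of the continuous representative makes the definite description denote, so
  any continuous representative computes the point value.\<close>

lemma point_value_eq:
  fixes \<iota> :: "'v::real_inner \<Rightarrow>\<^sub>L 'h::real_inner"
  assumes "0 < T" and "continuous_on {0..T} g" and "AE t in time_measure T. g t = \<iota> (x t)"
    and "s \<in> {0..T}"
  shows "point_value T \<iota> x s = g s"
  unfolding point_value_def
proof (rule the_equality)
  fix k
  assume "\<exists>g. continuous_on {0..T} g \<and> (AE t in time_measure T. g t = \<iota> (x t)) \<and> g s = k"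
  then obtain h where h: "continuous_on {0..T} h" "AE t in time_measure T. h t = \<iota> (x t)" "h s = k"
    by blast
  have "AE t in time_measure T. h t = g t"
    using assms(3) h(2) by eventually_elim simp
  then show "k = g s"
    using continuous_AE_eq_imp_eq[OF assms(1) h(1) assms(2) _ assms(4)] h(3) by simp
qed (use assms in blast)

section \<open>The dual norms of a subspace\<close>

lemma inner_le_dual_norm:
  fixes \<iota> :: "'v::real_inner \<Rightarrow>\<^sub>L 'h::real_inner"
  assumes "subspace W" "w \<in> W"
  shows "\<iota> v \<bullet> \<iota> w \<le> dual_norm \<iota> W v * norm w"
proof (cases "w = 0")
  case False
  let ?u = "(1 / norm w) *\<^sub>R w"
  have "\<iota> v \<bullet> \<iota> ?u \<le> dual_norm \<iota> W v"
    unfolding dual_norm_def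
  proof (rule cSUP_upper)
    show "bdd_above ((\<lambda>w. \<iota> v \<bullet> \<iota> w) ` {w \<in> W. norm w = 1})"
    proof (rule bdd_aboveI2[of _ _ "norm (\<iota> v) * norm \<iota>"])
      fix w assume "w \<in> {w \<in> W. norm w = 1}"
      then have "norm (\<iota> w) \<le> norm \<iota>"
        using norm_blinfun[of \<iota> w] by simp
      then have "norm (\<iota> v) * norm (\<iota> w) \<le> norm (\<iota> v) * norm \<iota>"
        by (simp add: mult_left_mono)
      then show "\<iota> v \<bullet> \<iota> w \<le> norm (\<iota> v) * norm \<iota>"
        using norm_cauchy_schwarz[of "\<iota> v" "\<iota> w"] by linarith
    qed
  qed (use assms False in \<open>auto intro: subspace_scale\<close>)
  then show ?thesis
    using False by (simp add: blinfun.scaleR_right field_simps)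
qed (simp add: blinfun.zero_right)

text \<open>The supremum in \<open>dual_norm\<close> is informative only over a nonempty set, which
  is where a nonzero subspace enters.\<close>

lemma unit_vectors_nonempty:
  fixes W :: "'v::real_normed_vector set"
  assumes "subspace W" "W \<noteq> {0}"
  shows "{w \<in> W. norm w = 1} \<noteq> {}"
proof -
  obtain w where "w \<in> W" "w \<noteq> 0"
    using assms subspace_0[OF assms(1)] by blast
  then have "(1 / norm w) *\<^sub>R w \<in> {w \<in> W. norm w = 1}"
    using assms by (auto intro: subspace_scale)
  then show ?thesis by blast
qed

lemma dual_norm_le:
  fixes \<iota> :: "'v::real_inner \<Rightarrow>\<^sub>L 'h::real_inner"
  assumes "subspace W" "W \<noteq> {0}" and "\<And>w. w \<in> W \<Longrightarrow> norm w = 1 \<Longrightarrow> \<iota> v \<bullet> \<iota> w \<le> k"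
  shows "dual_norm \<iota> W v \<le> k"
  unfolding dual_norm_def
  by (rule cSUP_least[OF unit_vectors_nonempty]) (use assms in auto)

lemma dual_norm_nonneg:
  fixes \<iota> :: "'v::real_inner \<Rightarrow>\<^sub>L 'h::real_inner"
  assumes "subspace W" "W \<noteq> {0}"
  shows "0 \<le> dual_norm \<iota> W v"
proof -
  obtain w where w: "w \<in> W" "norm w = 1"
    using unit_vectors_nonempty[OF assms] by blast
  then show ?thesis
    using inner_le_dual_norm[OF assms(1), of w \<iota> v] inner_le_dual_norm[OF assms(1), of "- w" \<iota> v]
      assms(1) by (simp add: blinfun.minus_right subspace_neg)
qed

lemma dual_norm_le_norm:
  fixes \<iota> :: "'v::real_inner \<Rightarrow>\<^sub>L 'h::real_inner"
  assumes "subspace W" "W \<noteq> {0}"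
  shows "dual_norm \<iota> W v \<le> (norm \<iota>)\<^sup>2 * norm v"
proof (rule dual_norm_le[OF assms])
  fix w :: 'v assume "norm w = 1"
  then have "norm (\<iota> v) * norm (\<iota> w) \<le> (norm \<iota> * norm v) * norm \<iota>"
    using norm_blinfun[of \<iota> v] norm_blinfun[of \<iota> w] by (intro mult_mono) auto
  then show "\<iota> v \<bullet> \<iota> w \<le> (norm \<iota>)\<^sup>2 * norm v"
    using norm_cauchy_schwarz[of "\<iota> v" "\<iota> w"] by (simp add: power2_eq_square algebra_simps)
qed

text \<open>A bounded sublinear functional is Lipschitz. Continuity later gives measurability of the
  discrete dual norm of a derivative.\<close>

lemma continuous_dual_norm:
  fixes \<iota> :: "'v::real_inner \<Rightarrow>\<^sub>L 'h::real_inner"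
  assumes W: "subspace W" "W \<noteq> {0}"
  shows "continuous_on UNIV (dual_norm \<iota> W)"
proof -
  have sub: "dual_norm \<iota> W v \<le> dual_norm \<iota> W v' + (norm \<iota>)\<^sup>2 * norm (v - v')" for v v'
  proof (rule dual_norm_le[OF W])
    fix w assume w: "w \<in> W" "norm w = 1"
    have "\<iota> v \<bullet> \<iota> w = \<iota> v' \<bullet> \<iota> w + \<iota> (v - v') \<bullet> \<iota> w"
      by (simp add: blinfun.diff_right inner_diff_left)
    also have "\<dots> \<le> dual_norm \<iota> W v' + dual_norm \<iota> W (v - v')"
      using inner_le_dual_norm[OF W(1) w(1), of \<iota>] w(2) by (metis add_mono mult.right_neutral)
    finally show "\<iota> v \<bullet> \<iota> w \<le> dual_norm \<iota> W v' + (norm \<iota>)\<^sup>2 * norm (v - v')"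
      using dual_norm_le_norm[OF W, of \<iota> "v - v'"] by linarith
  qed
  have "dist (dual_norm \<iota> W v) (dual_norm \<iota> W v') \<le> (norm \<iota>)\<^sup>2 * dist v v'" for v v'
    using sub[of v v'] sub[of v' v] by (auto simp: dist_norm norm_minus_commute)
  then have "((norm \<iota>)\<^sup>2)-lipschitz_on UNIV (dual_norm \<iota> W)"
    by (intro lipschitz_onI) auto
  then show ?thesis
    by (rule lipschitz_on_continuous_on)
qed

text \<open>This carries a derivative found in V over to the dual of V, where \<open>X_space\<close>
  asks for it.\<close>

lemma bounded_linear_to_dual:
  fixes \<iota> :: "'v::real_inner \<Rightarrow>\<^sub>L 'h::real_inner"
  shows "bounded_linear (to_dual \<iota>)"
proof (rule bounded_linear_intro[where K = "(norm \<iota>)\<^sup>2"])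
  fix v w :: 'v and r :: real
  show "to_dual \<iota> (v + w) = to_dual \<iota> v + to_dual \<iota> w"
    by (rule blinfun_eqI) (simp add: to_dual_def blinfun.add_right blinfun.add_left inner_simps)
  show "to_dual \<iota> (r *\<^sub>R v) = r *\<^sub>R to_dual \<iota> v"
    by (rule blinfun_eqI) (simp add: to_dual_def blinfun.scaleR_right blinfun.scaleR_left)
  show "norm (to_dual \<iota> v) \<le> norm v * (norm \<iota>)\<^sup>2"
  proof (rule norm_blinfun_bound)
    fix w
    have "norm (\<iota> v) * norm (\<iota> w) \<le> (norm \<iota> * norm v) * (norm \<iota> * norm w)"
      using norm_blinfun[of \<iota> v] norm_blinfun[of \<iota> w] by (intro mult_mono) auto
    then show "norm (to_dual \<iota> v w) \<le> norm v * (norm \<iota>)\<^sup>2 * norm w"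
      using Cauchy_Schwarz_ineq2[of "\<iota> v" "\<iota> w"]
      by (simp add: to_dual_def power2_eq_square algebra_simps)
  qed simp
qed

section \<open>The H-orthogonal projection onto the Galerkin space\<close>

text \<open>With a basis of \<open>W\<close> that is orthonormal in H, coordinates are H-inner
  products and the mass matrix is the identity. Projection and semidiscrete system then have
  explicit formulas.\<close>

locale galerkin_space =
  fixes \<iota> :: "'v::{real_inner,banach,second_countable_topology} \<Rightarrow>\<^sub>L
              'h::{real_inner,banach,second_countable_topology}"
    and E W :: "'v set"
  assumes inj: "inj (blinfun_apply \<iota>)" and fin: "finite E"
    and orthonormal: "\<And>e e'. e \<in> E \<Longrightarrow> e' \<in> E \<Longrightarrow> \<iota> e \<bullet> \<iota> e' = (if e = e' then 1 else 0)"
    and span: "span E = W" and nonzero: "W \<noteq> {0}"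
begin

lemma subspace: "subspace W"
  using span by auto

lemma E_in: "e \<in> E \<Longrightarrow> e \<in> W"
  using span span_base by blast

text \<open>This is the operator Q of the overview: orthogonality is meant in H, while its size will
  be measured in V.\<close>

definition proj :: "'v \<Rightarrow> 'v" where
  "proj v = (\<Sum>e\<in>E. (\<iota> v \<bullet> \<iota> e) *\<^sub>R e)"

lemma linear_proj: "linear proj"
  unfolding proj_def
  by (intro linearI) (simp_all add: blinfun.add_right blinfun.scaleR_right inner_simps
      scaleR_add_left sum.distrib scaleR_sum_right)

lemma proj_in: "proj v \<in> W"
  unfolding proj_def by (intro subspace_sum[OF subspace] subspace_scale[OF subspace] E_in)

lemma proj_id: "w \<in> W \<Longrightarrow> proj w = w"
proof (rule linear_eq_on[where g = "\<lambda>w. w" and B = E])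
  show "proj e = e" if "e \<in> E" for e
  proof -
    have "proj e = (\<Sum>e'\<in>E. if e' = e then e' else 0)"
      unfolding proj_def using orthonormal[OF that] by (intro sum.cong) auto
    then show ?thesis
      using that fin by simp
  qed
qed (use span linear_proj linear_id in \<open>auto simp: id_def\<close>)

text \<open>The vector with coordinates \<open>l e\<close> represents \<open>l\<close> on
  \<open>W\<close> through the H-inner product, and its pairing with \<open>v\<close> sees only
  \<open>proj v\<close>. This is why a \<open>W\<close>-valued derivative ignores
  \<open>v - proj v\<close>.\<close>

lemma proj_functional:
  assumes "linear l"
  shows "(\<Sum>e\<in>E. l e * (\<iota> e \<bullet> \<iota> v)) = (l (proj v) :: real)"
  unfolding proj_def linear_sum[OF assms] linear_cmul[OF assms]
  by (simp add: inner_commute mult.commute)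

lemma bounded_linear_proj: "bounded_linear proj"
  unfolding proj_def
  by (intro bounded_linear_sum bounded_linear_scaleR_const bounded_linear_compose[OF
      bounded_linear_inner_left blinfun.bounded_linear_right])

definition ratio :: real where
  "ratio = Sup (dual_norm_ratios \<iota> W)"

text \<open>Injectivity of \<open>\<iota>\<close> makes the pairing of \<open>w\<close> with itself
  positive, so the quotients of dual norms have nonzero denominators.\<close>

lemma dual_norm_pos:
  assumes "w \<in> W" "w \<noteq> 0"
  shows "0 < dual_norm \<iota> W w"
proof -
  have "\<iota> w \<noteq> 0"
    using inj assms(2) by (metis blinfun.zero_right injD)
  then have "0 < \<iota> w \<bullet> \<iota> w"
    by simp
  then have "0 < dual_norm \<iota> W w * norm w"
    using inner_le_dual_norm[OF subspace assms(1), of \<iota> w] by linarith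
  then show ?thesis
    using dual_norm_nonneg[OF subspace nonzero, of \<iota> w] by (auto simp: less_le)
qed

lemma dual_norm_UNIV_le:
  assumes "bdd_above (dual_norm_ratios \<iota> W)" "w \<in> W"
  shows "dual_norm \<iota> UNIV w \<le> ratio * dual_norm \<iota> W w"
proof (cases "w = 0")
  case True
  obtain e :: 'v where "e \<in> W" "e \<noteq> 0"
    using nonzero subspace_0[OF subspace] by blast
  then have "(UNIV :: 'v set) \<noteq> {0}" by blast
  then have "dual_norm \<iota> UNIV w \<le> 0"
    using True by (intro dual_norm_le) (auto simp: blinfun.zero_right)
  moreover have "dual_norm \<iota> W w = 0"
    using True dual_norm_le_norm[OF subspace nonzero, of \<iota> w] dual_norm_nonneg[OF subspace nonzero, of \<iota> w]
    by simp
  ultimately show ?thesis by simp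
next
  case False
  have "dual_norm \<iota> UNIV w / dual_norm \<iota> W w \<le> ratio"
    unfolding ratio_def using assms False by (intro cSup_upper) (auto simp: dual_norm_ratios_def)
  then show ?thesis
    using dual_norm_pos[OF assms(2) False] by (simp add: pos_divide_le_eq)
qed

text \<open>Enlarging the set of test vectors from \<open>W\<close> to V can only increase the dual
  norm.\<close>

lemma ratio_ge_1:
  assumes "bdd_above (dual_norm_ratios \<iota> W)"
  shows "1 \<le> ratio"
proof -
  obtain w where w: "w \<in> W" "w \<noteq> 0"
    using nonzero subspace_0[OF subspace] by blast
  have "dual_norm \<iota> W w \<le> dual_norm \<iota> UNIV w"
    by (rule dual_norm_le[OF subspace nonzero]) (metis inner_le_dual_norm subspace_UNIV UNIV_I mult.right_neutral)
  also have "\<dots> \<le> ratio * dual_norm \<iota> W w"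
    by (rule dual_norm_UNIV_le[OF assms w(1)])
  finally show ?thesis
    using dual_norm_pos[OF w] by simp
qed

text \<open>Duality: the V-inner product with \<open>proj v\<close> is represented on
  \<open>W\<close> by a vector \<open>m\<close>. Its discrete dual norm is at most
  \<open>norm (proj v)\<close>, while its full dual norm controls the pairing with an arbitrary
  \<open>v\<close>; \<open>ratio\<close> compares the two.\<close>

lemma norm_proj_le:
  assumes "bdd_above (dual_norm_ratios \<iota> W)"
  shows "norm (proj v) \<le> ratio * norm v"
proof -
  \<comment> \<open>\<open>m\<close> is the H-representative on \<open>W\<close> of the V-inner
    product with \<open>proj v\<close>.\<close>
  define m where "m = (\<Sum>e\<in>E. (proj v \<bullet> e) *\<^sub>R e)"
  have m_in: "m \<in> W"
    unfolding m_def by (intro subspace_sum[OF subspace] subspace_scale[OF subspace] E_in)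
  have m: "\<iota> m \<bullet> \<iota> w = proj v \<bullet> proj w" for w
    using proj_functional[of "\<lambda>u. proj v \<bullet> u" w]
    by (simp add: m_def blinfun.sum_right blinfun.scaleR_right inner_sum_left bounded_linear.linear bounded_linear_inner_right)
  have "dual_norm \<iota> W m \<le> norm (proj v)"
  proof (rule dual_norm_le[OF subspace nonzero])
    fix w assume "w \<in> W" "norm w = 1"
    then show "\<iota> m \<bullet> \<iota> w \<le> norm (proj v)"
      using norm_cauchy_schwarz[of "proj v" w] by (simp add: m proj_id)
  qed
  then have "ratio * dual_norm \<iota> W m \<le> ratio * norm (proj v)"
    using ratio_ge_1[OF assms] by (simp add: mult_left_mono)
  then have 1: "dual_norm \<iota> UNIV m \<le> ratio * norm (proj v)"
    using dual_norm_UNIV_le[OF assms m_in] by linarith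
  have "(norm (proj v))\<^sup>2 = \<iota> m \<bullet> \<iota> v"
    by (simp add: m power2_norm_eq_inner)
  also have "\<dots> \<le> dual_norm \<iota> UNIV m * norm v"
    by (rule inner_le_dual_norm) auto
  also have "\<dots> \<le> ratio * norm (proj v) * norm v"
    using 1 by (simp add: mult_right_mono)
  finally have "norm (proj v) * norm (proj v) \<le> norm (proj v) * (ratio * norm v)"
    by (simp add: power2_eq_square mult.assoc mult.left_commute)
  then show ?thesis
    using ratio_ge_1[OF assms] by (cases "proj v = 0") auto
qed

text \<open>The triangle inequality would give \<open>1 + ratio\<close>. Instead
  \<open>projection_complement_bound\<close> is applied to the part \<open>p\<close> in the range
  and the part \<open>q\<close> in the kernel, since \<open>proj\<close> maps each combination to
  its \<open>p\<close> part.\<close>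

lemma norm_proj_complement_le:
  assumes "bdd_above (dual_norm_ratios \<iota> W)"
  shows "norm (v - proj v) \<le> ratio * norm v"
proof (rule power2_le_imp_le)
  define p q where "p = proj v" and "q = v - proj v"
  have sq: "(norm (\<alpha> *\<^sub>R p + \<beta> *\<^sub>R q))\<^sup>2 = \<alpha>\<^sup>2 * (norm p)\<^sup>2 + 2 * \<alpha> * \<beta> * (p \<bullet> q) + \<beta>\<^sup>2 * (norm q)\<^sup>2" for \<alpha> \<beta>
    unfolding power2_norm_eq_inner
    by (simp add: inner_simps inner_commute power2_eq_square algebra_simps)
  have "(norm q)\<^sup>2 \<le> ratio\<^sup>2 * ((norm p)\<^sup>2 + 2 * (p \<bullet> q) + (norm q)\<^sup>2)"
  proof (rule projection_complement_bound)
    fix \<alpha> \<beta>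
    have "proj (\<alpha> *\<^sub>R p + \<beta> *\<^sub>R q) = \<alpha> *\<^sub>R p"
      by (simp add: linear_add[OF linear_proj] linear_cmul[OF linear_proj] linear_diff[OF linear_proj]
          p_def q_def proj_id proj_in)
    then have "norm (\<alpha> *\<^sub>R p) \<le> ratio * norm (\<alpha> *\<^sub>R p + \<beta> *\<^sub>R q)"
      using norm_proj_le[OF assms, of "\<alpha> *\<^sub>R p + \<beta> *\<^sub>R q"] by simp
    then have "(norm (\<alpha> *\<^sub>R p))\<^sup>2 \<le> (ratio * norm (\<alpha> *\<^sub>R p + \<beta> *\<^sub>R q))\<^sup>2"
      by (rule power_mono) simp
    then show "\<alpha>\<^sup>2 * (norm p)\<^sup>2 \<le> ratio\<^sup>2 * (\<alpha>\<^sup>2 * (norm p)\<^sup>2 + 2 * \<alpha> * \<beta> * (p \<bullet> q) + \<beta>\<^sup>2 * (norm q)\<^sup>2)"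
      by (simp add: power_mult_distrib flip: sq)
  qed (use ratio_ge_1[OF assms] in auto)
  also have "\<dots> = ratio\<^sup>2 * (norm (1 *\<^sub>R p + 1 *\<^sub>R q))\<^sup>2"
    by (subst sq) simp
  finally show "(norm (v - proj v))\<^sup>2 \<le> (ratio * norm v)\<^sup>2"
    by (simp add: p_def q_def power_mult_distrib)
qed (use ratio_ge_1[OF assms] in simp)

end

text \<open>The image of a spanning set is orthogonalised in H, normalised there, and pulled back
  along the injective embedding.\<close>

lemma galerkin_space_exists:
  fixes \<iota> :: "'v::{real_inner,banach,second_countable_topology} \<Rightarrow>\<^sub>L
              'h::{real_inner,banach,second_countable_topology}"
  assumes inj: "inj (blinfun_apply \<iota>)" and B: "finite B" "span B = W" and "W \<noteq> {0}"
  shows "\<exists>E. galerkin_space \<iota> E W"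
proof -
  have lin: "linear (blinfun_apply \<iota>)"
    by (simp add: bounded_linear.linear blinfun.bounded_linear_right)
  obtain C where C: "finite C" "span C = span (blinfun_apply \<iota> ` B)" "pairwise orthogonal C"
    using basis_orthogonal[of "blinfun_apply \<iota> ` B"] B(1) by auto
  have ran: "span C = blinfun_apply \<iota> ` W"
    using C(2) B(2) linear_span_image[OF lin, of B] by simp
  \<comment> \<open>Pairwise orthogonality permits the zero vector, which cannot be
    normalised.\<close>
  define N where "N = (\<lambda>c. (1 / norm c) *\<^sub>R c) ` (C - {0})"
  have "span N = span C"
  proof
    show "span N \<subseteq> span C"
      unfolding N_def by (intro span_minimal) (auto intro: span_scale span_base)
    have "c \<in> span N" if "c \<in> C" for c
    proof (cases "c = 0")
      case False
      then have "(1 / norm c) *\<^sub>R c \<in> span N"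
        using that unfolding N_def by (intro span_base) auto
      then have "norm c *\<^sub>R (1 / norm c) *\<^sub>R c \<in> span N"
        by (rule span_scale)
      then show ?thesis
        using False by simp
    qed (simp add: span_zero)
    then show "span C \<subseteq> span N"
      by (intro span_minimal) auto
  qed
  define E where "E = inv_into UNIV (blinfun_apply \<iota>) ` N"
  have "N \<subseteq> range (blinfun_apply \<iota>)"
    using \<open>span N = span C\<close> ran span_superset[of N] by auto
  then have N_E: "blinfun_apply \<iota> ` E = N"
    unfolding E_def by (simp add: image_image f_inv_into_f subset_iff)
  have "blinfun_apply \<iota> ` span E = blinfun_apply \<iota> ` W"
    using linear_span_image[OF lin, of E] N_E \<open>span N = span C\<close> ran by simp
  then have "span E = W"
    by (simp add: inj_image_eq_iff[OF inj])
  moreover have "\<iota> e \<bullet> \<iota> e' = (if e = e' then 1 else 0)" if "e \<in> E" "e' \<in> E" for e e'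
  proof -
    have "\<iota> e \<in> N" "\<iota> e' \<in> N"
      using that N_E by auto
    then obtain c c' where c: "\<iota> e = (1 / norm c) *\<^sub>R c" "c \<in> C" "c \<noteq> 0"
      "\<iota> e' = (1 / norm c') *\<^sub>R c'" "c' \<in> C" "c' \<noteq> 0"
      unfolding N_def by blast
    have one: "\<iota> e \<bullet> \<iota> e = 1"
      using c by (simp add: dot_square_norm power2_eq_square)
    show ?thesis
    proof (cases "c = c'")
      case True
      then have "e = e'"
        using c inj by (metis injD)
      then show ?thesis
        using one by simp
    next
      case False
      then have "\<iota> e \<bullet> \<iota> e' = 0"
        using C(3) c by (auto simp: pairwise_def orthogonal_def)
      \<comment> \<open>By \<open>one\<close>, a vanishing inner product excludes
        \<open>e = e'\<close>.\<close>
      then show ?thesis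
        using one by auto
    qed
  qed
  moreover have "finite E"
    unfolding E_def N_def using C(1) by simp
  ultimately show ?thesis
    using inj assms(4) by (intro exI[of _ E]) (unfold_locales, auto)
qed

section \<open>Square integrable functions of time\<close>

text \<open>The pairing is jointly continuous, and both V and its dual are second countable, so
  pairs of measurable functions are measurable.\<close>

lemma borel_measurable_blinfun_apply:
  fixes f :: "'a \<Rightarrow> 'v::{real_inner,banach,second_countable_topology} \<Rightarrow>\<^sub>L real"
  assumes "f \<in> borel_measurable M" "g \<in> borel_measurable M"
  shows "(\<lambda>x. f x (g x)) \<in> borel_measurable M"
  using assms
proof (rule borel_measurable_continuous_Pair)
  show "continuous_on UNIV (\<lambda>x. blinfun_apply (fst x) (snd x :: 'v) :: real)"
    by (rule bounded_bilinear.continuous_on[OF bounded_bilinear_blinfun_apply]) (intro continuous_intros)+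
qed

text \<open>Only strong measurability of \<open>\<alpha>\<close> is assumed, so \<open>y\<close> is approximated by simple functions.\<close>

lemma borel_measurable_strong_apply:
  fixes \<alpha> :: "'a \<Rightarrow> 'v::{real_normed_vector,second_countable_topology} \<Rightarrow>\<^sub>L 'w::real_normed_vector"
  assumes \<alpha>: "\<And>v. (\<lambda>t. \<alpha> t v) \<in> borel_measurable M" and y: "y \<in> borel_measurable M"
  shows "(\<lambda>t. \<alpha> t (y t)) \<in> borel_measurable M"
proof -
  obtain s where s: "\<forall>i. simple_function M (s i)" "\<forall>t\<in>space M. (\<lambda>i. s i t) \<longlonglongrightarrow> y t"
    using borel_measurable_implies_sequence_metric[OF y] by blast
  show ?thesis
  proof (rule borel_measurable_LIMSEQ_metric)
    fix i
    have "s i \<in> measurable M (count_space (s i ` space M))"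
      using s(1) by (auto simp: simple_function_def measurable_count_space_eq2)
    moreover have "countable (s i ` space M)"
      using s(1) by (auto simp: simple_function_def countable_finite)
    ultimately show "(\<lambda>t. \<alpha> t (s i t)) \<in> borel_measurable M"
      by (rule measurable_compose_countable'[where f = "\<lambda>v t. \<alpha> t v" and g = "s i", OF \<alpha>])
  next
    fix t assume "t \<in> space M"
    then show "(\<lambda>i. \<alpha> t (s i t)) \<longlonglongrightarrow> \<alpha> t (y t)"
      using s(2) by (intro blinfun.tendsto tendsto_const) auto
  qed
qed

text \<open>The square of a sum is at most twice the sum of the squares. Two majorants suit both
  linear combinations and the derivative of the dual solution.\<close>

lemma Lsq_bound:
  assumes r: "r \<in> borel_measurable (time_measure T)" and y: "y \<in> Lsq T" and z: "z \<in> Lsq T"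
    and bound: "\<And>t. t \<in> {0<..<T} \<Longrightarrow> norm (r t) \<le> C * norm (y t) + D * norm (z t)"
  shows "r \<in> Lsq T"
proof -
  have "integrable (time_measure T) (\<lambda>t. (norm (r t))\<^sup>2)"
  proof (rule Bochner_Integration.integrable_bound)
    show "integrable (time_measure T) (\<lambda>t. 2 * C\<^sup>2 * (norm (y t))\<^sup>2 + 2 * D\<^sup>2 * (norm (z t))\<^sup>2)"
      using y z by (simp add: Lsq_def)
    have "(norm (r t))\<^sup>2 \<le> 2 * C\<^sup>2 * (norm (y t))\<^sup>2 + 2 * D\<^sup>2 * (norm (z t))\<^sup>2"
      if "t \<in> {0<..<T}" for t
    proof -
      have "(norm (r t))\<^sup>2 \<le> (C * norm (y t) + D * norm (z t))\<^sup>2"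
        using bound[OF that] by (intro power_mono) auto
      also have "\<dots> \<le> 2 * (C * norm (y t))\<^sup>2 + 2 * (D * norm (z t))\<^sup>2"
        using sum_squares_bound[of "C * norm (y t)" "D * norm (z t)"] by (simp add: power2_sum)
      finally show ?thesis
        by (simp add: power_mult_distrib)
    qed
    then show "AE t in time_measure T. norm ((norm (r t))\<^sup>2) \<le>
        norm (2 * C\<^sup>2 * (norm (y t))\<^sup>2 + 2 * D\<^sup>2 * (norm (z t))\<^sup>2)"
      by (intro AE_I2) (simp add: space_restrict_space)
  qed (use r in measurable)
  then show ?thesis
    using r by (simp add: Lsq_def)
qed

lemma Lsq_combination:
  fixes y :: "real \<Rightarrow> 'e::{real_normed_vector,second_countable_topology}"
  assumes "y \<in> Lsq T" "z \<in> Lsq T"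
  shows "(\<lambda>t. a *\<^sub>R y t + b *\<^sub>R z t) \<in> Lsq T"
proof (rule Lsq_bound[OF _ assms])
  show "(\<lambda>t. a *\<^sub>R y t + b *\<^sub>R z t) \<in> borel_measurable (time_measure T)"
    using assms by (intro borel_measurable_add borel_measurable_scaleR) (auto simp: Lsq_def)
  show "norm (a *\<^sub>R y t + b *\<^sub>R z t) \<le> \<bar>a\<bar> * norm (y t) + \<bar>b\<bar> * norm (z t)" for t
    using norm_triangle_ineq[of "a *\<^sub>R y t" "b *\<^sub>R z t"] by simp
qed

lemma Lsq_diff:
  fixes y :: "real \<Rightarrow> 'e::{real_normed_vector,second_countable_topology}"
  assumes "y \<in> Lsq T" "z \<in> Lsq T"
  shows "(\<lambda>t. y t - z t) \<in> Lsq T"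
  using Lsq_combination[OF assms, of 1 "-1"] by simp

lemma Lsq_bounded_linear:
  assumes "bounded_linear B" and "y \<in> Lsq T"
  shows "(\<lambda>t. B (y t)) \<in> Lsq T"
proof -
  obtain K where K: "\<And>v. norm (B v) \<le> norm v * K"
    using bounded_linear.bounded[OF assms(1)] by blast
  have "(\<lambda>t. B (y t)) \<in> borel_measurable (time_measure T)"
    by (rule borel_measurable_continuous_on[OF linear_continuous_on[OF assms(1)]])
      (use assms(2) in \<open>simp add: Lsq_def\<close>)
  then show ?thesis
    by (rule Lsq_bound[OF _ assms(2) assms(2), where C = K and D = 0]) (use K in \<open>simp add: mult.commute\<close>)
qed

lemma Lsq_continuous:
  fixes x :: "real \<Rightarrow> 'e::real_normed_vector"
  assumes "continuous_on UNIV x"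
  shows "x \<in> Lsq T"
  unfolding Lsq_def
  by (intro CollectI conjI time_measure_borel_measurable borel_measurable_continuous_onI
      integrable_continuous_time continuous_intros assms)

lemma integrable_Lsq_norm_mult:
  assumes "y \<in> Lsq T" "z \<in> Lsq T"
  shows "integrable (time_measure T) (\<lambda>t. norm (y t) * norm (z t))"
    and "(LINT t|time_measure T. norm (y t) * norm (z t)) \<le> Lsq_norm T y * Lsq_norm T z"
proof -
  have [measurable]: "y \<in> borel_measurable (time_measure T)" "z \<in> borel_measurable (time_measure T)"
    and sq: "integrable (time_measure T) (\<lambda>t. (norm (y t))\<^sup>2)" "integrable (time_measure T) (\<lambda>t. (norm (z t))\<^sup>2)"
    using assms by (auto simp: Lsq_def)
  show "integrable (time_measure T) (\<lambda>t. norm (y t) * norm (z t))"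
    by (rule integrable_mult_of_square_integrable[OF _ _ sq]) measurable
  show "(LINT t|time_measure T. norm (y t) * norm (z t)) \<le> Lsq_norm T y * Lsq_norm T z"
    unfolding Lsq_norm_def by (rule integral_Cauchy_Schwarz[OF _ _ sq]) measurable
qed

lemma integrable_Lsq_mult_bound:
  fixes h :: "real \<Rightarrow> real"
  assumes "h \<in> borel_measurable (time_measure T)" "y \<in> Lsq T" "z \<in> Lsq T"
    and "\<And>t. t \<in> {0<..<T} \<Longrightarrow> \<bar>h t\<bar> \<le> C * (norm (y t) * norm (z t))"
  shows "integrable (time_measure T) h"
proof (rule Bochner_Integration.integrable_bound)
  show "integrable (time_measure T) (\<lambda>t. C * (norm (y t) * norm (z t)))"
    using integrable_Lsq_norm_mult(1)[OF assms(2,3)] by simp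
  have "norm (h t) \<le> norm (C * (norm (y t) * norm (z t)))" if "t \<in> {0<..<T}" for t
    using assms(4)[OF that] by simp
  then show "AE t in time_measure T. norm (h t) \<le> norm (C * (norm (y t) * norm (z t)))"
    by (intro AE_I2) (simp add: space_restrict_space)
qed (use assms in auto)

lemma Lsq_norm_nonneg: "0 \<le> Lsq_norm T y"
  by (simp add: Lsq_norm_def)

lemma Lsq_norm_power2: "(Lsq_norm T y)\<^sup>2 = (LINT t|time_measure T. (norm (y t))\<^sup>2)"
  by (simp add: Lsq_norm_def)

section \<open>The discrete dual problem\<close>

text \<open>The data for one outcome: the random bounds have become numbers, and the operators are
  measurable only in the strong sense.\<close>

locale coercive_problem = galerkin_space \<iota> E W
  for \<iota> :: "'v::{real_inner,banach,second_countable_topology} \<Rightarrow>\<^sub>L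
            'h::{real_inner,banach,second_countable_topology}" and E W :: "'v set" +
  fixes T :: real and \<alpha> :: "real \<Rightarrow> 'v \<Rightarrow>\<^sub>L ('v \<Rightarrow>\<^sub>L real)" and a_min a_max :: real
  assumes T_pos: "0 < T" and a_min: "0 < a_min" and a_max: "0 < a_max"
    and \<alpha>_meas: "\<And>v. (\<lambda>t. \<alpha> t v) \<in> borel_measurable (time_measure T)"
    and \<alpha>_bounded: "\<And>t v w. t \<in> {0<..<T} \<Longrightarrow> \<bar>\<alpha> t v w\<bar> \<le> a_max * norm v * norm w"
    and \<alpha>_coercive: "\<And>t v. t \<in> {0<..<T} \<Longrightarrow> a_min * (norm v)\<^sup>2 \<le> \<alpha> t v v"
    and ratios_bdd: "bdd_above (dual_norm_ratios \<iota> W)"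
begin

text \<open>The integrand is the right-hand side of the backward equation tested with
  \<open>e\<close>. The basis vector sits in the first slot of the form, because the problem is the
  adjoint one.\<close>

lemma integrable_dual_rhs:
  assumes x: "continuous_on UNIV x" and z: "z \<in> Lsq T"
  shows "integrable (time_measure T) (\<lambda>s. z s \<bullet> e - \<alpha> s e (x s))"
proof (intro Bochner_Integration.integrable_diff)
  show "integrable (time_measure T) (\<lambda>s. z s \<bullet> e)"
    using Lsq_integrable[OF z] by simp
  show "integrable (time_measure T) (\<lambda>s. \<alpha> s e (x s))"
  proof (rule Bochner_Integration.integrable_bound)
    show "integrable (time_measure T) (\<lambda>s. a_max * norm e * norm (x s))"
      by (intro integrable_continuous_time continuous_intros x)
    show "(\<lambda>s. \<alpha> s e (x s)) \<in> borel_measurable (time_measure T)"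
      by (intro borel_measurable_blinfun_apply \<alpha>_meas time_measure_borel_measurable
          borel_measurable_continuous_onI x)
    show "AE s in time_measure T. norm (\<alpha> s e (x s)) \<le> norm (a_max * norm e * norm (x s))"
      using \<alpha>_bounded by (intro AE_I2) (auto simp: space_restrict_space intro: order_trans[OF _ abs_ge_self])
  qed
qed

text \<open>Picard iteration for \<open>y t = exp (k * t) *\<^sub>R x t\<close>, which is a contraction for \<open>k\<close> large.\<close>

lemma dual_solution_exists:
  assumes z: "z \<in> Lsq T"
  shows "\<exists>x. continuous_on UNIV x \<and>
    (\<forall>t\<in>{0..T}. x t = (\<Sum>e\<in>E. tail_int T (\<lambda>s. z s \<bullet> e - \<alpha> s e (x s)) t *\<^sub>R e))"
proof -
  \<comment> \<open>A component along \<open>e\<close> costs \<open>a_max * norm e\<close>, and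
    reassembling the vector costs another \<open>norm e\<close>. The weight improves the Lipschitz
    constant \<open>L\<close> to \<open>L / k\<close>, which is at most 1/2.\<close>
  define L where "L = a_max * (\<Sum>e\<in>E. (norm e)\<^sup>2)"
  define k where "k = 2 * L + 1"
  have "0 \<le> L"
    unfolding L_def using a_max by (simp add: sum_nonneg)
  then have k: "0 < k" "L / k \<le> 1 / 2"
    unfolding k_def by (auto simp: field_simps)
  define w where "w y s = exp (- k * s) *\<^sub>R (y s :: 'v)" for y s
  define p where "p y e s = z s \<bullet> e - \<alpha> s e (w y s)" for y e s
  \<comment> \<open>Clamping time to \<open>{0..T}\<close> makes the iterates bounded on the whole
    line, so they live in the complete space of bounded continuous functions.\<close>
  define cl where "cl t = max 0 (min T t)" for t
  have cl: "cl t \<in> {0..T}" for t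
    using T_pos by (auto simp: cl_def)
  define \<Psi> where "\<Psi> y t = (\<Sum>e\<in>E. (exp (k * t) * tail_int T (p y e) t) *\<^sub>R e)" for y t
  have w_cont: "continuous_on UNIV (w y)" if "continuous_on UNIV y" for y
    unfolding w_def[abs_def] by (intro continuous_intros that)
  have p_int: "integrable (time_measure T) (p y e)" if "continuous_on UNIV y" for y e
    unfolding p_def by (intro integrable_dual_rhs w_cont that z)
  have \<Psi>_cont: "continuous_on UNIV (\<Psi> y)" if "continuous_on UNIV y" for y
    unfolding \<Psi>_def[abs_def] by (intro continuous_intros continuous_tail_int p_int that)
  have cl_cont: "continuous_on UNIV cl"
    unfolding cl_def[abs_def] by (intro continuous_intros)
  define \<Phi> where "\<Phi> y = Bcontfun (\<lambda>t. \<Psi> (apply_bcontfun y) (cl t))" for y :: "real \<Rightarrow>\<^sub>C 'v"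
  have \<Phi>: "apply_bcontfun (\<Phi> y) t = \<Psi> (apply_bcontfun y) (cl t)" for y t
  proof -
    have "compact (\<Psi> (apply_bcontfun y) ` {0..T})"
      by (intro compact_continuous_image continuous_on_subset[OF \<Psi>_cont]) auto
    then have "bounded (range (\<lambda>t. \<Psi> (apply_bcontfun y) (cl t)))"
      using cl by (elim bounded_subset[OF compact_imp_bounded]) auto
    moreover have "continuous_on UNIV (\<lambda>t. \<Psi> (apply_bcontfun y) (cl t))"
      by (rule continuous_on_compose2[OF \<Psi>_cont cl_cont]) auto
    ultimately show ?thesis
      unfolding \<Phi>_def by (subst Bcontfun_inverse) (auto simp: bcontfun_def)
  qed
  have contract: "dist (\<Phi> y) (\<Phi> y') \<le> 1 / 2 * dist y y'" for y y'
  proof (rule dist_bound)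
    fix t
    define \<tau> where "\<tau> = cl t"
    define D where "D = dist y y'"
    have \<tau>: "\<tau> \<in> {0..T}" and D: "0 \<le> D"
      using cl by (auto simp: \<tau>_def D_def)
    have y_int: "integrable (time_measure T) (p (apply_bcontfun y) e)"
      "integrable (time_measure T) (p (apply_bcontfun y') e)" for e
      by (intro p_int; simp)+
    have tail: "\<bar>tail_int T (p (apply_bcontfun y) e) \<tau> - tail_int T (p (apply_bcontfun y') e) \<tau>\<bar>
        \<le> a_max * norm e * D / k * exp (- k * \<tau>)" for e
    proof -
      let ?C = "a_max * norm e * D"
      have "\<bar>tail_int T (p (apply_bcontfun y) e) \<tau> - tail_int T (p (apply_bcontfun y') e) \<tau>\<bar> =
          \<bar>tail_int T (\<lambda>s. p (apply_bcontfun y) e s - p (apply_bcontfun y') e s) \<tau>\<bar>"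
        by (simp add: tail_int_diff[OF y_int])
      also have "\<dots> \<le> tail_int T (\<lambda>s. ?C * exp (- k * s)) \<tau>"
      proof (rule abs_tail_int_le)
        show "integrable (time_measure T) (\<lambda>s. p (apply_bcontfun y) e s - p (apply_bcontfun y') e s)"
          by (intro Bochner_Integration.integrable_diff y_int)
        show "integrable (time_measure T) (\<lambda>s. ?C * exp (- k * s))"
          by (intro integrable_continuous_time continuous_intros)
        fix s assume s: "s \<in> {0<..<T}"
        have "p (apply_bcontfun y) e s - p (apply_bcontfun y') e s =
            \<alpha> s e (exp (- k * s) *\<^sub>R (y' s - y s))"
          by (simp add: p_def w_def blinfun.diff_right blinfun.scaleR_right right_diff_distrib)
        then have "\<bar>p (apply_bcontfun y) e s - p (apply_bcontfun y') e s\<bar> \<le>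
            a_max * norm e * (exp (- k * s) * dist (y s) (y' s))"
          using \<alpha>_bounded[OF s, of e "exp (- k * s) *\<^sub>R (y' s - y s)"]
          by (simp add: dist_norm norm_minus_commute)
        also have "\<dots> \<le> a_max * norm e * (exp (- k * s) * D)"
          unfolding D_def using a_max by (intro mult_left_mono dist_bounded) auto
        finally show "\<bar>p (apply_bcontfun y) e s - p (apply_bcontfun y') e s\<bar> \<le> ?C * exp (- k * s)"
          by (simp add: mult_ac)
      qed
      also have "\<dots> = - (?C / k * exp (- k * T)) - - (?C / k * exp (- k * \<tau>))"
        using k by (intro tail_int_FTC[OF \<tau>, where \<phi> = "\<lambda>s. - (?C / k * exp (- k * s))"])
          (auto intro!: derivative_eq_intros continuous_intros)
      \<comment> \<open>The contribution of the end point \<open>T\<close> is at most 0 and is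
        dropped.\<close>
      also have "\<dots> \<le> ?C / k * exp (- k * \<tau>)"
        using k a_max D by simp
      finally show ?thesis .
    qed
    have "dist (\<Phi> y t) (\<Phi> y' t) = norm (\<Sum>e\<in>E. (exp (k * \<tau>) *
        (tail_int T (p (apply_bcontfun y) e) \<tau> - tail_int T (p (apply_bcontfun y') e) \<tau>)) *\<^sub>R e)"
      by (simp add: \<Phi> \<Psi>_def \<tau>_def dist_norm right_diff_distrib scaleR_diff_left flip: sum_subtractf)
    also have "\<dots> \<le> (\<Sum>e\<in>E. exp (k * \<tau>) * (a_max * norm e * D / k * exp (- k * \<tau>)) * norm e)"
    proof (rule sum_norm_le)
      fix e
      have "norm ((exp (k * \<tau>) *
          (tail_int T (p (apply_bcontfun y) e) \<tau> - tail_int T (p (apply_bcontfun y') e) \<tau>)) *\<^sub>R e) =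
          exp (k * \<tau>) *
          \<bar>tail_int T (p (apply_bcontfun y) e) \<tau> - tail_int T (p (apply_bcontfun y') e) \<tau>\<bar> * norm e"
        by (simp add: abs_mult)
      also have "\<dots> \<le> exp (k * \<tau>) * (a_max * norm e * D / k * exp (- k * \<tau>)) * norm e"
        by (intro mult_right_mono mult_left_mono tail) auto
      finally show "norm ((exp (k * \<tau>) *
          (tail_int T (p (apply_bcontfun y) e) \<tau> - tail_int T (p (apply_bcontfun y') e) \<tau>)) *\<^sub>R e)
          \<le> exp (k * \<tau>) * (a_max * norm e * D / k * exp (- k * \<tau>)) * norm e" .
    qed
    also have "\<dots> = (\<Sum>e\<in>E. a_max * D / k * (norm e)\<^sup>2)"
      by (intro sum.cong refl) (simp add: exp_minus power2_eq_square field_simps)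
    also have "\<dots> = L / k * D"
      unfolding L_def by (simp add: sum_distrib_left sum_distrib_right sum_divide_distrib mult_ac)
    also have "\<dots> \<le> 1 / 2 * D"
      using k D by (intro mult_right_mono) auto
    finally show "dist (\<Phi> y t) (\<Phi> y' t) \<le> 1 / 2 * dist y y'"
      by (simp add: D_def)
  qed
  obtain y where y: "\<Phi> y = y"
    using banach_fix_type[of "1 / 2" \<Phi>] contract by auto
  let ?x = "w (apply_bcontfun y)"
  have "?x t = (\<Sum>e\<in>E. tail_int T (\<lambda>s. z s \<bullet> e - \<alpha> s e (?x s)) t *\<^sub>R e)" if "t \<in> {0..T}" for t
  proof -
    have "apply_bcontfun y t = \<Psi> (apply_bcontfun y) t"
      using \<Phi>[of y t] that by (simp add: y cl_def)
    then show ?thesis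
      by (simp add: w_def[of _ t] \<Psi>_def scaleR_sum_right p_def[abs_def] exp_minus mult.assoc[symmetric])
  qed
  then show ?thesis
    using w_cont[of "apply_bcontfun y"] by (intro exI[of _ ?x]) auto
qed

lemma borel_measurable_form:
  assumes "y \<in> Lsq T" "x \<in> Lsq T"
  shows "(\<lambda>t. \<alpha> t (y t) (x t)) \<in> borel_measurable (time_measure T)"
  by (rule borel_measurable_blinfun_apply[OF borel_measurable_strong_apply[OF \<alpha>_meas]])
    (use assms in \<open>simp_all add: Lsq_def\<close>)

lemma integrable_form:
  assumes "y \<in> Lsq T" "x \<in> Lsq T"
  shows "integrable (time_measure T) (\<lambda>t. \<alpha> t (y t) (x t))"
  by (rule integrable_Lsq_mult_bound[OF borel_measurable_form[OF assms] assms, where C = a_max])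
    (use \<alpha>_bounded in \<open>simp add: mult.assoc\<close>)

lemma integrable_Lsq_inner:
  fixes y z :: "real \<Rightarrow> 'v"
  assumes "y \<in> Lsq T" "z \<in> Lsq T"
  shows "integrable (time_measure T) (\<lambda>t. y t \<bullet> z t)"
  by (rule integrable_Lsq_mult_bound[OF _ assms, where C = 1])
    (use assms Cauchy_Schwarz_ineq2 in \<open>auto simp: Lsq_def intro: borel_measurable_inner\<close>)

lemma integrable_B_star:
  assumes "x \<in> X_space T \<iota>" "y \<in> Lsq T"
  shows "integrable (time_measure T) (\<lambda>t. (- time_deriv T \<iota> x t) (y t) + \<alpha> t (y t) (x t))"
proof (rule Bochner_Integration.integrable_add)
  have td: "time_deriv T \<iota> x \<in> Lsq T"
    using time_deriv(1)[OF assms(1)] .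
  show "integrable (time_measure T) (\<lambda>t. (- time_deriv T \<iota> x t) (y t))"
  proof (rule integrable_Lsq_mult_bound[OF _ td assms(2), where C = 1])
    show "(\<lambda>t. (- time_deriv T \<iota> x t) (y t)) \<in> borel_measurable (time_measure T)"
      by (rule borel_measurable_blinfun_apply[OF borel_measurable_uminus])
        (use td assms(2) in \<open>simp_all add: Lsq_def\<close>)
    show "\<bar>(- time_deriv T \<iota> x t) (y t)\<bar> \<le> 1 * (norm (time_deriv T \<iota> x t) * norm (y t))" for t
      using norm_blinfun[of "time_deriv T \<iota> x t" "y t"] by (simp add: blinfun.minus_left)
  qed
  show "integrable (time_measure T) (\<lambda>t. \<alpha> t (y t) (x t))"
    using assms by (intro integrable_form) (auto simp: X_space_def)
qed

lemma B_star_combination: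
  assumes "x \<in> X_space T \<iota>" "y \<in> Lsq T" "z \<in> Lsq T"
  shows "B_star T \<iota> \<alpha> (\<lambda>t. a *\<^sub>R y t + b *\<^sub>R z t) x = a * B_star T \<iota> \<alpha> y x + b * B_star T \<iota> \<alpha> z x"
proof -
  let ?b = "\<lambda>y t. (- time_deriv T \<iota> x t) (y t) + \<alpha> t (y t) (x t)"
  have "B_star T \<iota> \<alpha> (\<lambda>t. a *\<^sub>R y t + b *\<^sub>R z t) x = (LINT t|time_measure T. a * ?b y t + b * ?b z t)"
    unfolding B_star_def
    by (rule Bochner_Integration.integral_cong)
      (simp_all add: blinfun.add_right blinfun.add_left blinfun.scaleR_right blinfun.scaleR_left algebra_simps)
  also have "\<dots> = a * B_star T \<iota> \<alpha> y x + b * B_star T \<iota> \<alpha> z x"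
    unfolding B_star_def
    using integrable_B_star[OF assms(1,2)] integrable_B_star[OF assms(1,3)]
    by (subst Bochner_Integration.integral_add) auto
  finally show ?thesis .
qed

text \<open>The test function solves the dual problem with the Riesz representative of \<open>z\<close> on the right-hand
  side.  For \<open>y\<close> outside \<open>Yh_space T W\<close> the residual is carried by the \<open>H\<close>-orthogonal complement.\<close>

lemma dual_test_function:
  assumes z: "z \<in> Lsq T"
  shows "\<exists>x. x \<in> X_space T \<iota> \<and> x \<in> Xh_space T \<iota> W \<and> a_min * Lsq_norm T x \<le> Lsq_norm T z \<and>
    (\<forall>y\<in>Lsq T. B_star T \<iota> \<alpha> y x =
      (LINT t|time_measure T. z t \<bullet> proj (y t) + \<alpha> t (y t - proj (y t)) (x t)))"
proof -
  let ?N = "time_measure T"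
  obtain x where x_cont: "continuous_on UNIV x"
    and x: "\<And>t. t \<in> {0..T} \<Longrightarrow> x t = (\<Sum>e\<in>E. tail_int T (\<lambda>s. z s \<bullet> e - \<alpha> s e (x s)) t *\<^sub>R e)"
    using dual_solution_exists[OF z] by blast
  \<comment> \<open>Tested on \<open>W\<close>, the dual problem says that minus the derivative of
    \<open>x\<close> equals \<open>l t\<close>.\<close>
  define l where "l t v = z t \<bullet> v - \<alpha> t v (x t)" for t v
  define X where "X e = tail_int T (\<lambda>s. l s e)" for e
  \<comment> \<open>\<open>r t\<close> represents \<open>- l t\<close> on \<open>W\<close> through
    the H-inner product, and turns out to be the weak derivative of \<open>x\<close>.\<close>
  define r where "r t = (\<Sum>e\<in>E. (- l t e) *\<^sub>R e)" for t
  have x_X: "x t = (\<Sum>e\<in>E. X e t *\<^sub>R e)" if "t \<in> {0..T}" for t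
    using x[OF that] by (simp add: X_def l_def)
  have l_int: "integrable ?N (\<lambda>t. l t e)" for e
    unfolding l_def by (rule integrable_dual_rhs[OF x_cont z])
  have X_cont: "continuous_on UNIV (X e)" for e
    unfolding X_def by (rule continuous_tail_int[OF l_int])
  have x_in: "x t \<in> W" if "t \<in> {0..T}" for t
    unfolding x_X[OF that] by (intro subspace_sum[OF subspace] subspace_scale[OF subspace] E_in)
  have r_in: "r t \<in> W" for t
    unfolding r_def by (intro subspace_sum[OF subspace] subspace_scale[OF subspace] E_in)
  have x_Lsq: "x \<in> Lsq T"
    by (rule Lsq_continuous[OF x_cont])
  have l_linear: "linear (l t)" for t
    unfolding l_def
    by (intro linearI) (simp_all add: inner_simps blinfun.add_right blinfun.add_left blinfun.scaleR_right
        blinfun.scaleR_left algebra_simps)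
  have r_l: "\<iota> (r t) \<bullet> \<iota> v = - l t (proj v)" for t v
    using proj_functional[OF l_linear, of t v]
    by (simp add: r_def blinfun.sum_right blinfun.scaleR_right inner_sum_left sum_negf blinfun.minus_right)
  have r_meas: "r \<in> borel_measurable ?N"
    unfolding r_def[abs_def]
    by (intro borel_measurable_sum borel_measurable_scaleR borel_measurable_uminus borel_measurable_const
        borel_measurable_integrable[OF l_int])
  have r_Lsq: "r \<in> Lsq T"
  proof (rule Lsq_bound[OF r_meas z x_Lsq])
    fix t assume t: "t \<in> {0<..<T}"
    have "norm (r t) \<le> (\<Sum>e\<in>E. (norm (z t) * norm e + a_max * norm e * norm (x t)) * norm e)"
      unfolding r_def
    proof (rule sum_norm_le)
      fix e
      have "\<bar>l t e\<bar> \<le> norm (z t) * norm e + a_max * norm e * norm (x t)"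
        unfolding l_def using Cauchy_Schwarz_ineq2[of "z t" e] \<alpha>_bounded[OF t, of e "x t"] by linarith
      then show "norm ((- l t e) *\<^sub>R e) \<le> (norm (z t) * norm e + a_max * norm e * norm (x t)) * norm e"
        by (simp add: mult_right_mono)
    qed
    also have "\<dots> = (\<Sum>e\<in>E. (norm e)\<^sup>2) * norm (z t) + (a_max * (\<Sum>e\<in>E. (norm e)\<^sup>2)) * norm (x t)"
      by (simp add: sum_distrib_left sum_distrib_right power2_eq_square algebra_simps sum.distrib)
    finally show "norm (r t) \<le> (\<Sum>e\<in>E. (norm e)\<^sup>2) * norm (z t) + (a_max * (\<Sum>e\<in>E. (norm e)\<^sup>2)) * norm (x t)" .
  qed
  have x_deriv: "weak_deriv T x r"
  proof (rule weak_deriv_cong)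
    show "weak_deriv T (\<lambda>t. \<Sum>e\<in>E. X e t *\<^sub>R e) r"
      unfolding r_def[abs_def]
    proof (rule weak_deriv_sum[OF fin])
      fix e
      show "weak_deriv T (\<lambda>t. X e t *\<^sub>R e) (\<lambda>t. (- l t e) *\<^sub>R e)"
        unfolding X_def
        by (rule weak_deriv_bounded_linear[OF bounded_linear_scaleR_left weak_deriv_tail_int[OF l_int]])
          (use l_int integrable_continuous_time[OF continuous_tail_int[OF l_int]] in auto)
    qed (use l_int integrable_continuous_time[OF X_cont] in auto)
    show "(\<Sum>e\<in>E. X e t *\<^sub>R e) = x t" if "t \<in> {0<..<T}" for t
      using x_X[of t] that by simp
  qed
  then have dual_deriv: "weak_deriv T (\<lambda>t. to_dual \<iota> (x t)) (\<lambda>t. to_dual \<iota> (r t))"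
    by (rule weak_deriv_bounded_linear[OF bounded_linear_to_dual _ Lsq_integrable[OF x_Lsq] Lsq_integrable[OF r_Lsq]])
  have r_dual: "(\<lambda>t. to_dual \<iota> (r t)) \<in> Lsq T"
    by (rule Lsq_bounded_linear[OF bounded_linear_to_dual r_Lsq])
  have "point_value T \<iota> x T = \<iota> (x T)"
    by (rule point_value_eq[OF T_pos])
      (use T_pos in \<open>auto intro!: continuous_intros continuous_on_subset[OF x_cont]\<close>)
  also have "x T = 0"
    using x_X[of T] T_pos by (simp add: X_def tail_int_T)
  finally have x_T: "point_value T \<iota> x T = 0"
    by (simp add: blinfun.zero_right)
  have x_X_space: "x \<in> X_space T \<iota>"
    unfolding X_space_def using x_Lsq r_dual dual_deriv x_T by blast
  \<comment> \<open>\<open>Xh_space\<close> measures the derivative in the discrete dual norm, which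
    a multiple of the V-norm dominates.\<close>
  have "(\<lambda>t. dual_norm \<iota> W (r t)) \<in> Lsq T"
  proof (rule Lsq_bound[OF _ r_Lsq r_Lsq, where C = "(norm \<iota>)\<^sup>2" and D = 0])
    show "(\<lambda>t. dual_norm \<iota> W (r t)) \<in> borel_measurable ?N"
      by (rule borel_measurable_continuous_on[OF continuous_dual_norm[OF subspace nonzero] r_meas])
    show "norm (dual_norm \<iota> W (r t)) \<le> (norm \<iota>)\<^sup>2 * norm (r t) + 0 * norm (r t)" for t
      using dual_norm_nonneg[OF subspace nonzero, of \<iota> "r t"] dual_norm_le_norm[OF subspace nonzero, of \<iota> "r t"]
      by simp
  qed
  then have "integrable ?N (\<lambda>t. (dual_norm \<iota> W (r t))\<^sup>2)"
    by (simp add: Lsq_def)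
  moreover have "x \<in> Yh_space T W"
    unfolding Yh_space_def using x_Lsq x_in by (auto intro!: AE_I2 simp: space_restrict_space)
  ultimately have x_Xh_space: "x \<in> Xh_space T \<iota> W"
    unfolding Xh_space_def using r_meas r_in x_deriv x_T by (auto intro!: exI[of _ r])

  have X_inner: "X e t = \<iota> e \<bullet> \<iota> (x t)" if "e \<in> E" "t \<in> {0..T}" for e t
  proof -
    have "\<iota> e \<bullet> \<iota> (x t) = (\<Sum>e'\<in>E. X e' t * (\<iota> e \<bullet> \<iota> e'))"
      by (simp add: x_X[OF that(2)] blinfun.sum_right blinfun.scaleR_right inner_sum_right)
    also have "\<dots> = (\<Sum>e'\<in>E. if e' = e then X e' t else 0)"
      using orthonormal[OF that(1)] by (intro sum.cong) auto
    finally show ?thesis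
      using that fin by simp
  qed
  have lX_int: "integrable ?N (\<lambda>t. l t e * X e t)" for e
    using integrable_continuous_scaleR[OF X_cont l_int] by (simp add: mult.commute)
  \<comment> \<open>Integration by parts of \<open>X e\<close> with itself: twice this integral is
    the square of \<open>X e 0\<close>, as the terminal value is 0.\<close>
  have "0 \<le> (LINT t|?N. l t e * X e t)" for e
    using tail_int_product[OF l_int[of e] l_int[of e]] zero_le_square[of "X e 0"]
    by (simp add: X_def del: zero_le_square)
  then have "0 \<le> (LINT t|?N. (\<Sum>e\<in>E. l t e * X e t))"
    using lX_int by (simp add: sum_nonneg)
  also have "\<dots> = (LINT t|?N. z t \<bullet> x t - \<alpha> t (x t) (x t))"
  proof (rule Bochner_Integration.integral_cong)
    fix t assume "t \<in> space ?N"
    then have t: "t \<in> {0..T}"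
      by (auto simp: space_restrict_space)
    have "(\<Sum>e\<in>E. l t e * X e t) = l t (proj (x t))"
      using proj_functional[OF l_linear, of t "x t"] X_inner[OF _ t] by simp
    then show "(\<Sum>e\<in>E. l t e * X e t) = z t \<bullet> x t - \<alpha> t (x t) (x t)"
      by (simp add: proj_id[OF x_in[OF t]] l_def)
  qed simp
  also have "\<dots> = (LINT t|?N. z t \<bullet> x t) - (LINT t|?N. \<alpha> t (x t) (x t))"
    by (rule Bochner_Integration.integral_diff[OF integrable_Lsq_inner[OF z x_Lsq] integrable_form[OF x_Lsq x_Lsq]])
  finally have energy: "(LINT t|?N. \<alpha> t (x t) (x t)) \<le> (LINT t|?N. z t \<bullet> x t)"
    by simp
  have "a_min * (Lsq_norm T x)\<^sup>2 = (LINT t|?N. a_min * (norm (x t))\<^sup>2)"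
    by (simp add: Lsq_norm_power2)
  also have "\<dots> \<le> (LINT t|?N. \<alpha> t (x t) (x t))"
    using x_Lsq \<alpha>_coercive
    by (intro integral_mono integrable_form[OF x_Lsq x_Lsq]) (auto simp: Lsq_def space_restrict_space)
  also have "\<dots> \<le> (LINT t|?N. norm (z t) * norm (x t))"
    using energy by (rule order_trans)
      (intro integral_mono integrable_Lsq_inner integrable_Lsq_norm_mult z x_Lsq norm_cauchy_schwarz)
  also have "\<dots> \<le> Lsq_norm T z * Lsq_norm T x"
    by (rule integrable_Lsq_norm_mult(2)[OF z x_Lsq])
  finally have "(a_min * Lsq_norm T x) * Lsq_norm T x \<le> Lsq_norm T z * Lsq_norm T x"
    by (simp add: power2_eq_square mult.assoc)
  then have x_bound: "a_min * Lsq_norm T x \<le> Lsq_norm T z"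
    using Lsq_norm_nonneg[of T x] Lsq_norm_nonneg[of T z] by (cases "Lsq_norm T x = 0") auto

  have "B_star T \<iota> \<alpha> y x = (LINT t|?N. z t \<bullet> proj (y t) + \<alpha> t (y t - proj (y t)) (x t))"
    if y: "y \<in> Lsq T" for y
    unfolding B_star_def
  proof (rule integral_cong_AE)
    show "(\<lambda>t. (- time_deriv T \<iota> x t) (y t) + \<alpha> t (y t) (x t)) \<in> borel_measurable ?N"
      by (rule borel_measurable_integrable[OF integrable_B_star[OF x_X_space y]])
    have py: "(\<lambda>t. proj (y t)) \<in> Lsq T"
      by (rule Lsq_bounded_linear[OF bounded_linear_proj y])
    show "(\<lambda>t. z t \<bullet> proj (y t) + \<alpha> t (y t - proj (y t)) (x t)) \<in> borel_measurable ?N"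
      by (intro borel_measurable_add borel_measurable_form[OF Lsq_diff[OF y py] x_Lsq]
          borel_measurable_integrable[OF integrable_Lsq_inner[OF z py]])
    \<comment> \<open>Uniqueness replaces the chosen derivative by \<open>r\<close>; by
      \<open>r_l\<close> its pairing with \<open>y t\<close> produces
      \<open>l t (proj (y t))\<close>, and the rest of the form keeps
      \<open>y t - proj (y t)\<close>.\<close>
    have "AE t in ?N. time_deriv T \<iota> x t = to_dual \<iota> (r t)"
      by (rule weak_deriv_unique[OF time_deriv(1)[OF x_X_space] r_dual time_deriv(2)[OF x_X_space] dual_deriv])
    then show "AE t in ?N. (- time_deriv T \<iota> x t) (y t) + \<alpha> t (y t) (x t) =
        z t \<bullet> proj (y t) + \<alpha> t (y t - proj (y t)) (x t)"
      by eventually_elim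
        (simp add: to_dual_def blinfun.minus_left r_l l_def blinfun.diff_right blinfun.diff_left)
  qed
  then show ?thesis
    using x_X_space x_Xh_space x_bound by blast
qed

section \<open>Stability and quasi-optimality for one outcome\<close>

text \<open>Here \<open>z\<close> is the Galerkin projection of \<open>y\<close>. The identity
  \<open>orth\<close> is requested only on test functions common to the continuous and the discrete
  problem; the solution of the dual problem with data \<open>z\<close> is one of them.\<close>

lemma galerkin_stable:
  assumes y: "y \<in> Lsq T" and z: "z \<in> Yh_space T W"
    and orth: "\<And>x. x \<in> X_space T \<iota> \<Longrightarrow> x \<in> Xh_space T \<iota> W \<Longrightarrow> B_star T \<iota> \<alpha> y x = B_star T \<iota> \<alpha> z x"
  shows "Lsq_norm T z \<le> ratio * (1 + a_max / a_min) * Lsq_norm T y"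
proof -
  let ?N = "time_measure T"
  have z_Lsq: "z \<in> Lsq T" and z_W: "AE t in ?N. z t \<in> W"
    using z by (auto simp: Yh_space_def)
  obtain x where x: "x \<in> X_space T \<iota>" "x \<in> Xh_space T \<iota> W"
    and x_bound: "a_min * Lsq_norm T x \<le> Lsq_norm T z"
    and B: "\<And>y. y \<in> Lsq T \<Longrightarrow> B_star T \<iota> \<alpha> y x =
      (LINT t|?N. z t \<bullet> proj (y t) + \<alpha> t (y t - proj (y t)) (x t))"
    using dual_test_function[OF z_Lsq] by blast
  have x_Lsq: "x \<in> Lsq T"
    using x(1) by (simp add: X_space_def)
  note int = integrable_Lsq_norm_mult(1)[OF z_Lsq y] integrable_Lsq_norm_mult(1)[OF y x_Lsq]
  have rhs_int: "integrable ?N (\<lambda>t. z t \<bullet> proj (y t) + \<alpha> t (y t - proj (y t)) (x t))"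
    if y: "y \<in> Lsq T" for y
    by (intro Bochner_Integration.integrable_add integrable_Lsq_inner integrable_form Lsq_diff
        Lsq_bounded_linear[OF bounded_linear_proj] z_Lsq x_Lsq y)
  have "(Lsq_norm T z)\<^sup>2 = B_star T \<iota> \<alpha> z x"
    unfolding Lsq_norm_power2 B[OF z_Lsq]
  proof (rule integral_cong_AE)
    \<comment> \<open>\<open>proj\<close> fixes \<open>z t\<close>, so the term with the form
      vanishes.\<close>
    show "AE t in ?N. (norm (z t))\<^sup>2 = z t \<bullet> proj (z t) + \<alpha> t (z t - proj (z t)) (x t)"
      using z_W by eventually_elim
        (simp add: proj_id power2_norm_eq_inner blinfun.zero_left blinfun.zero_right)
  qed (use z_Lsq rhs_int[OF z_Lsq] in \<open>auto simp: Lsq_def\<close>)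
  also have "\<dots> = (LINT t|?N. z t \<bullet> proj (y t) + \<alpha> t (y t - proj (y t)) (x t))"
    using orth[OF x] B[OF y] by simp
  also have "\<dots> \<le> (LINT t|?N. ratio * (norm (z t) * norm (y t)) + a_max * ratio * (norm (y t) * norm (x t)))"
  proof (rule integral_mono[OF rhs_int[OF y]])
    fix t assume "t \<in> space ?N"
    then have t: "t \<in> {0<..<T}"
      by (simp add: space_restrict_space)
    have "z t \<bullet> proj (y t) \<le> norm (z t) * norm (proj (y t))"
      by (rule norm_cauchy_schwarz)
    also have "\<dots> \<le> norm (z t) * (ratio * norm (y t))"
      by (intro mult_left_mono norm_proj_le[OF ratios_bdd]) simp
    finally have 1: "z t \<bullet> proj (y t) \<le> ratio * (norm (z t) * norm (y t))"
      by (simp add: mult_ac)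
    have "\<alpha> t (y t - proj (y t)) (x t) \<le> a_max * norm (y t - proj (y t)) * norm (x t)"
      using \<alpha>_bounded[OF t, of "y t - proj (y t)" "x t"] by linarith
    also have "\<dots> \<le> a_max * (ratio * norm (y t)) * norm (x t)"
      using a_max by (intro mult_left_mono mult_right_mono norm_proj_complement_le[OF ratios_bdd]) auto
    finally show "z t \<bullet> proj (y t) + \<alpha> t (y t - proj (y t)) (x t) \<le>
        ratio * (norm (z t) * norm (y t)) + a_max * ratio * (norm (y t) * norm (x t))"
      using 1 by (simp add: mult_ac)
  qed (use int in simp)
  also have "\<dots> = ratio * (LINT t|?N. norm (z t) * norm (y t)) + a_max * ratio * (LINT t|?N. norm (y t) * norm (x t))"
    using int by simp
  also have "\<dots> \<le> ratio * (Lsq_norm T z * Lsq_norm T y) + a_max * ratio * (Lsq_norm T y * Lsq_norm T x)"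
    using a_max ratio_ge_1[OF ratios_bdd]
    by (intro add_mono mult_left_mono integrable_Lsq_norm_mult(2) z_Lsq y x_Lsq) auto
  also have "\<dots> \<le> ratio * (Lsq_norm T z * Lsq_norm T y) +
      a_max * ratio * (Lsq_norm T y * (Lsq_norm T z / a_min))"
    using a_max ratio_ge_1[OF ratios_bdd] a_min x_bound
    by (intro add_mono mult_left_mono Lsq_norm_nonneg order_refl) (auto simp: pos_le_divide_eq mult.commute)
  also have "\<dots> = Lsq_norm T z * (ratio * (1 + a_max / a_min) * Lsq_norm T y)"
    by (simp add: algebra_simps)
  finally have "Lsq_norm T z * Lsq_norm T z \<le> Lsq_norm T z * (ratio * (1 + a_max / a_min) * Lsq_norm T y)"
    by (simp add: power2_eq_square)
  moreover have "0 \<le> ratio * (1 + a_max / a_min) * Lsq_norm T y"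
    using a_max a_min ratio_ge_1[OF ratios_bdd] Lsq_norm_nonneg[of T y] by simp
  ultimately show ?thesis
    using Lsq_norm_nonneg[of T z] by (cases "Lsq_norm T z = 0") auto
qed

text \<open>The Galerkin projection fixes \<open>p\<close>, the difference of two discrete
  functions, and annihilates the error \<open>q\<close>. Hence \<open>a *\<^sub>R p t\<close> is
  stably bounded by \<open>a *\<^sub>R p t + b *\<^sub>R q t\<close>, and
  \<open>projection_complement_bound\<close> gives the same constant for \<open>q\<close>.\<close>

lemma galerkin_quasi_optimal:
  assumes u: "u \<in> Lsq T" and uh: "uh \<in> Yh_space T W" and y: "y \<in> Yh_space T W"
    and orth: "\<And>x. x \<in> X_space T \<iota> \<Longrightarrow> x \<in> Xh_space T \<iota> W \<Longrightarrow> B_star T \<iota> \<alpha> u x = B_star T \<iota> \<alpha> uh x"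
  shows "Lsq_norm T (\<lambda>t. u t - uh t) \<le> ratio * (1 + a_max / a_min) * Lsq_norm T (\<lambda>t. u t - y t)"
proof (rule power2_le_imp_le)
  let ?N = "time_measure T"
  let ?K = "ratio * (1 + a_max / a_min)"
  define p q where "p t = uh t - y t" and "q t = u t - uh t" for t
  have Lsq: "uh \<in> Lsq T" "y \<in> Lsq T" and W: "AE t in ?N. uh t \<in> W" "AE t in ?N. y t \<in> W"
    using uh y by (auto simp: Yh_space_def)
  have p: "p \<in> Lsq T" and q: "q \<in> Lsq T"
    unfolding p_def[abs_def] q_def[abs_def] by (intro Lsq_diff u Lsq)+
  have p_W: "AE t in ?N. p t \<in> W"
    using W by eventually_elim (simp add: p_def subspace_diff[OF subspace])
  have "1 \<le> 1 + a_max / a_min"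
    using a_min a_max by simp
  then have K: "1 \<le> ?K"
    using mult_mono[OF ratio_ge_1[OF ratios_bdd], of 1 "1 + a_max / a_min"] ratio_ge_1[OF ratios_bdd] by simp
  have sq: "(Lsq_norm T (\<lambda>t. a *\<^sub>R p t + b *\<^sub>R q t))\<^sup>2 =
      a\<^sup>2 * (Lsq_norm T p)\<^sup>2 + 2 * a * b * (LINT t|?N. p t \<bullet> q t) + b\<^sup>2 * (Lsq_norm T q)\<^sup>2" for a b
  proof -
    have "(norm (a *\<^sub>R p t + b *\<^sub>R q t))\<^sup>2 =
        a\<^sup>2 * (norm (p t))\<^sup>2 + 2 * a * b * (p t \<bullet> q t) + b\<^sup>2 * (norm (q t))\<^sup>2" for t
      unfolding power2_norm_eq_inner
      by (simp add: inner_simps inner_commute power2_eq_square algebra_simps)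
    then show ?thesis
      using p q integrable_Lsq_inner[OF p q] by (simp add: Lsq_norm_power2 Lsq_def)
  qed
  have "(Lsq_norm T q)\<^sup>2 \<le> ?K\<^sup>2 * ((Lsq_norm T p)\<^sup>2 + 2 * (LINT t|?N. p t \<bullet> q t) + (Lsq_norm T q)\<^sup>2)"
  proof (rule projection_complement_bound[OF K])
    fix a b :: real
    have "Lsq_norm T (\<lambda>t. a *\<^sub>R p t) \<le> ?K * Lsq_norm T (\<lambda>t. a *\<^sub>R p t + b *\<^sub>R q t)"
    proof (rule galerkin_stable)
      show "(\<lambda>t. a *\<^sub>R p t + b *\<^sub>R q t) \<in> Lsq T"
        by (rule Lsq_combination[OF p q])
      have "AE t in ?N. a *\<^sub>R p t \<in> W"
        using p_W by eventually_elim (rule subspace_scale[OF subspace])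
      then show "(\<lambda>t. a *\<^sub>R p t) \<in> Yh_space T W"
        using Lsq_combination[OF p p, of a 0] by (simp add: Yh_space_def)
      fix x assume x: "x \<in> X_space T \<iota>" "x \<in> Xh_space T \<iota> W"
      \<comment> \<open>Galerkin orthogonality of the error.\<close>
      have "B_star T \<iota> \<alpha> q x = 0"
        using B_star_combination[OF x(1) u Lsq(1), of 1 "-1"] orth[OF x] by (simp add: q_def[abs_def])
      then show "B_star T \<iota> \<alpha> (\<lambda>t. a *\<^sub>R p t + b *\<^sub>R q t) x = B_star T \<iota> \<alpha> (\<lambda>t. a *\<^sub>R p t) x"
        using B_star_combination[OF x(1) p q, of a b] B_star_combination[OF x(1) p q, of a 0] by simp
    qed
    then have "(Lsq_norm T (\<lambda>t. a *\<^sub>R p t))\<^sup>2 \<le> (?K * Lsq_norm T (\<lambda>t. a *\<^sub>R p t + b *\<^sub>R q t))\<^sup>2"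
      by (rule power_mono) (rule Lsq_norm_nonneg)
    then show "a\<^sup>2 * (Lsq_norm T p)\<^sup>2 \<le> ?K\<^sup>2 * (a\<^sup>2 * (Lsq_norm T p)\<^sup>2 + 2 * a * b * (LINT t|?N. p t \<bullet> q t) + b\<^sup>2 * (Lsq_norm T q)\<^sup>2)"
      using sq[of a 0] by (simp add: power_mult_distrib sq)
  qed auto
  also have "\<dots> = ?K\<^sup>2 * (Lsq_norm T (\<lambda>t. 1 *\<^sub>R p t + 1 *\<^sub>R q t))\<^sup>2"
    by (subst sq) simp
  also have "(\<lambda>t. 1 *\<^sub>R p t + 1 *\<^sub>R q t) = (\<lambda>t. u t - y t)"
    by (simp add: p_def q_def)
  finally show "(Lsq_norm T (\<lambda>t. u t - uh t))\<^sup>2 \<le> (?K * Lsq_norm T (\<lambda>t. u t - y t))\<^sup>2"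
    by (simp add: q_def[abs_def] power_mult_distrib)
  show "0 \<le> ?K * Lsq_norm T (\<lambda>t. u t - y t)"
    by (rule mult_nonneg_nonneg[OF order_trans[OF zero_le_one K] Lsq_norm_nonneg])
qed

end

section \<open>From a fixed outcome to almost every outcome\<close>

text \<open>Progressive measurability at the final time is joint measurability on
  \<open>{0..T}\<close>, and sections of jointly measurable functions are measurable.\<close>

lemma prog_measurable_path:
  assumes "prog_measurable T F X" and "0 < T" and "subalgebra M (F T)" and "\<omega> \<in> space M"
  shows "(\<lambda>t. X t \<omega>) \<in> borel_measurable (time_measure T)"
proof -
  have [measurable]: "(\<lambda>(s, \<omega>). X s \<omega>) \<in> borel_measurable (restrict_space borel {0..T} \<Otimes>\<^sub>M F T)"
    using assms(1,2) by (auto simp: prog_measurable_def)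
  have "\<omega> \<in> space (F T)"
    using assms(3,4) by (simp add: subalgebra_def)
  then have "(\<lambda>t. X t \<omega>) \<in> borel_measurable (restrict_space borel {0..T})"
    by measurable
  moreover have "(\<lambda>t. t) \<in> measurable (time_measure T) (restrict_space borel {0..T})"
    by (rule measurable_restrict_space2) (auto simp: space_restrict_space intro!: time_measure_borel_measurable)
  ultimately show ?thesis
    by (rule measurable_compose[rotated])
qed

theorem theorem7:
  fixes M :: "'w measure"
    and T :: real
    and F :: "real \<Rightarrow> 'w measure"
    and \<iota> :: "'v::{real_inner,banach,second_countable_topology} \<Rightarrow>\<^sub>L
              'h::{real_inner,banach,second_countable_topology}"
    and A :: "real \<Rightarrow> 'w \<Rightarrow> 'v \<Rightarrow>\<^sub>L ('v \<Rightarrow>\<^sub>L real)"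
    and A_min A_max \<rho> :: "'w \<Rightarrow> real"
    and f :: "real \<Rightarrow> 'w \<Rightarrow> 'v \<Rightarrow>\<^sub>L real"
    and u\<^sub>0 :: "'w \<Rightarrow> 'h"
    and Vh :: "'k \<Rightarrow> 'v set"
    and u :: "'w \<Rightarrow> real \<Rightarrow> 'v"
    and uh :: "'k \<Rightarrow> 'w \<Rightarrow> real \<Rightarrow> 'v"
    and c :: "'k \<Rightarrow> real"
  assumes "0 < T"
    and "prob_space M" and "complete_measure M" and "normal_filtration M T F"
    and "gelfand_triple \<iota>"
    and A_meas: "\<And>v. prog_measurable T F (\<lambda>t \<omega>. A t \<omega> v)"
    and "A_min \<in> borel_measurable M" and "A_max \<in> borel_measurable M"
    and A_pos: "AE \<omega> in M. 0 < A_min \<omega> \<and> 0 < A_max \<omega>"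
    and A_bounded: "AE \<omega> in M. \<forall>t\<in>{0..T}. \<forall>v w. \<bar>A t \<omega> v w\<bar> \<le> A_max \<omega> * norm v * norm w"
    and A_coercive: "AE \<omega> in M. \<forall>t\<in>{0..T}. \<forall>v. A t \<omega> v v \<ge> A_min \<omega> * (norm v)\<^sup>2"
    and \<rho>_def: "\<And>\<omega>. \<rho> \<omega> = A_max \<omega> / A_min \<omega>"
    and f_meas: "prog_measurable T F f"
    and f_Lsq: "AE \<omega> in M. (\<lambda>t. f t \<omega>) \<in> Lsq T"
    and "u\<^sub>0 \<in> borel_measurable M"
    and Vh_subspace: "\<And>k. subspace (Vh k)"
    and Vh_finite_dim: "\<And>k. \<exists>B. finite B \<and> span B = Vh k"
    and Vh_nonzero: "\<And>k. Vh k \<noteq> {0}"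
    and u_solution: "AE \<omega> in M. u \<omega> \<in> Lsq T \<and>
          (\<forall>x\<in>X_space T \<iota>.
             B_star T \<iota> (\<lambda>t. A t \<omega>) (u \<omega>) x = F_load T \<iota> (\<lambda>t. f t \<omega>) (u\<^sub>0 \<omega>) x)"
    and uh_solution: "\<And>k. AE \<omega> in M. uh k \<omega> \<in> Yh_space T (Vh k) \<and>
          (\<forall>x\<in>Xh_space T \<iota> (Vh k).
             B_star T \<iota> (\<lambda>t. A t \<omega>) (uh k \<omega>) x = F_load T \<iota> (\<lambda>t. f t \<omega>) (u\<^sub>0 \<omega>) x)"
    and c_def: "\<And>k. c k = Sup (dual_norm_ratios \<iota> (Vh k))"
    and c_finite: "\<And>k. bdd_above (dual_norm_ratios \<iota> (Vh k))"
  shows "\<forall>k. AE \<omega> in M.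
           Lsq_norm T (\<lambda>t. u \<omega> t - uh k \<omega> t) \<le>
           c k * (1 + \<rho> \<omega>) * (INF y\<in>Yh_space T (Vh k). Lsq_norm T (\<lambda>t. u \<omega> t - y t))"
proof
  fix k
  obtain B where B: "finite B" "span B = Vh k"
    using Vh_finite_dim by blast
  have inj: "inj (blinfun_apply \<iota>)"
    using \<open>gelfand_triple \<iota>\<close> by (simp add: gelfand_triple_def)
  obtain E where "galerkin_space \<iota> E (Vh k)"
    using galerkin_space_exists[OF inj B Vh_nonzero] ..
  then interpret galerkin_space \<iota> E "Vh k" .
  have c: "c k = ratio"
    by (simp add: c_def ratio_def)
  have "subalgebra M (F T)"
    using \<open>normal_filtration M T F\<close> \<open>0 < T\<close> by (simp add: normal_filtration_def)
  then have meas: "(\<lambda>t. A t \<omega> v) \<in> borel_measurable (time_measure T)" if "\<omega> \<in> space M" for \<omega> v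
    using prog_measurable_path[OF A_meas \<open>0 < T\<close>] that by blast
  show "AE \<omega> in M. Lsq_norm T (\<lambda>t. u \<omega> t - uh k \<omega> t) \<le>
      c k * (1 + \<rho> \<omega>) * (INF y\<in>Yh_space T (Vh k). Lsq_norm T (\<lambda>t. u \<omega> t - y t))"
    using AE_space A_pos A_bounded A_coercive u_solution uh_solution[of k]
  proof eventually_elim
    case (elim \<omega>)
    interpret coercive_problem \<iota> E "Vh k" T "\<lambda>t. A t \<omega>" "A_min \<omega>" "A_max \<omega>"
      by unfold_locales (use elim meas \<open>0 < T\<close> c_finite in auto)
    let ?K = "c k * (1 + \<rho> \<omega>)"
    have "0 < 1 + \<rho> \<omega>"
      using a_min a_max by (simp add: \<rho>_def add_pos_nonneg)
    then have K: "0 < ?K"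
      using ratio_ge_1[OF ratios_bdd] by (simp add: c)
    \<comment> \<open>Division by the positive constant turns the bounds for single \<open>y\<close>
      into a lower bound of the set whose infimum is taken; the set is nonempty since
      \<open>uh k \<omega>\<close> supplies an element.\<close>
    have "Lsq_norm T (\<lambda>t. u \<omega> t - uh k \<omega> t) / ?K \<le>
        (INF y\<in>Yh_space T (Vh k). Lsq_norm T (\<lambda>t. u \<omega> t - y t))"
    proof (rule cINF_greatest)
      show "Yh_space T (Vh k) \<noteq> {}"
        using elim by blast
      fix y assume "y \<in> Yh_space T (Vh k)"
      \<comment> \<open>On common test functions both solutions have the same load
        \<open>F_load\<close>, which is the orthogonality required.\<close>
      then have "Lsq_norm T (\<lambda>t. u \<omega> t - uh k \<omega> t) \<le> ?K * Lsq_norm T (\<lambda>t. u \<omega> t - y t)"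
        unfolding c \<rho>_def using elim by (intro galerkin_quasi_optimal) auto
      then show "Lsq_norm T (\<lambda>t. u \<omega> t - uh k \<omega> t) / ?K \<le> Lsq_norm T (\<lambda>t. u \<omega> t - y t)"
        using K by (simp add: pos_divide_le_eq mult.commute)
    qed
    then show ?case
      using K by (simp add: pos_divide_le_eq mult.commute)
  qed
qed

end
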